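(* Let $D$ and $b$ be positive integers. If $\Gamma$ is a distance-regular graph with classical parameters $(D,b,\alpha,\beta)$ such that $D\geq 9$ and $b\geq 2$, then $\alpha<b^2(b+1)+1$.
   Context: All graphs are finite, undirected and simple. A connected graph $\Gamma$ of diameter $D$ is distance-regular if for each $0\le i\le D$ there are integers $b_i,c_i$ such that for any two vertices $x,y$ at distance $i$, exactly $c_i$ neighbours of $y$ are at distance $i-1$ from $x$ and exactly $b_i$ neighbours of $y$ are at distance $i+1$ from $x$. Write $\left[\begin{smallmatrix} i\\ 1\end{smallmatrix}\right]_b=1+b+\dots+b^{i-1}$. A distance-regular graph of diameter $D$ has classical parameters $(D,b,\alpha,\beta)$ if for all $0\le i\le D$: $c_i=\left[\begin{smallmatrix} i\\ 1\end{smallmatrix}\right]_b\bigl(1+\alpha\left[\begin{smallmatrix} i-1\\ 1\end{smallmatrix}\right]_b\bigr)$ and $b_i=\bigl(\left[\begin{smallmatrix} D\\ 1\end{smallmatrix}\right]_b-\left[\begin{smallmatrix} i\\ 1\end{smallmatrix}\right]_b\bigr)\bigl(\beta-\alpha\left[\begin{smallmatrix} i\\ 1\end{smallmatrix}\right]_b\bigr)$. *)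

theory Defs
  imports
    Complex_Main
    "Graph_Theory.Digraph_Component"
    "Graph_Theory.Shortest_Path"
begin

text \<open>
  Finite simple undirected graphs are the instances of the locale \<^locale>\<open>graph\<close>: finite,
  symmetric digraphs without loops and parallel arcs. An edge is a pair of opposite arcs, so the
  neighbours of \<open>y\<close> are the \<open>z\<close> with \<open>y \<rightarrow>\<^bsub>G\<^esub> z\<close>.
\<close>

text \<open>Only meaningful if \<open>v\<close> is reachable from \<open>u\<close>, which holds wherever it is used below.\<close>

definition graph_dist :: "('a, 'b) pre_digraph \<Rightarrow> 'a \<Rightarrow> 'a \<Rightarrow> nat" where
  "graph_dist G u v = (LEAST n. \<exists>p. pre_digraph.awalk G u p v \<and> length p = n)"

text \<open>Agreement with the library's weighted distance, all arcs having weight 1.\<close>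

lemma (in wf_digraph) mu_unit_weights_eq_graph_dist:
  assumes "u \<rightarrow>\<^sup>* v"
  shows "\<mu> (\<lambda>_. 1) u v = ereal (real (graph_dist G u v))"
proof -
  have cost: "awalk_cost (\<lambda>_. 1) p = real (length p)" for p
    by (induction p) auto
  have "\<exists>n p. awalk u p v \<and> length p = n"
    using assms by (simp add: reachable_awalk)
  then have "\<exists>p. awalk u p v \<and> length p = graph_dist G u v"
    unfolding graph_dist_def by (rule LeastI_ex)
  moreover have "graph_dist G u v \<le> length p" if "awalk u p v" for p
    unfolding graph_dist_def using that by (intro Least_le) auto
  ultimately show ?thesis
    unfolding \<mu>_def cost by (intro antisym INF_greatest) (auto intro: INF_lower2)
qed

definition diameter :: "('a, 'b) pre_digraph \<Rightarrow> nat" where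
  "diameter G = Max {graph_dist G u v | u v. u \<in> verts G \<and> v \<in> verts G}"

text \<open>
  Distance \<open>i - 1\<close> is written \<open>graph_dist G x z + 1 = i\<close>, so that for \<open>i = 0\<close> no
  vertex qualifies and truncated subtraction plays no role.
\<close>

definition intersection_numbers ::
  "('a, 'b) pre_digraph \<Rightarrow> (nat \<Rightarrow> int) \<Rightarrow> (nat \<Rightarrow> int) \<Rightarrow> bool" where
  "intersection_numbers G bs cs \<longleftrightarrow>
    (\<forall>i \<le> diameter G. \<forall>x \<in> verts G. \<forall>y \<in> verts G. graph_dist G x y = i \<longrightarrow>
      int (card {z \<in> verts G. y \<rightarrow>\<^bsub>G\<^esub> z \<and> graph_dist G x z + 1 = i}) = cs i \<and>
      int (card {z \<in> verts G. y \<rightarrow>\<^bsub>G\<^esub> z \<and> graph_dist G x z = i + 1}) = bs i)"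

definition distance_regular :: "('a, 'b) pre_digraph \<Rightarrow> bool" where
  "distance_regular G \<longleftrightarrow>
    graph G \<and> Digraph_Component.connected G \<and> (\<exists>bs cs. intersection_numbers G bs cs)"

definition gauss_bracket :: "int \<Rightarrow> nat \<Rightarrow> real" where
  "gauss_bracket b i = (\<Sum>j<i. real_of_int b ^ j)"

text \<open>
  The values \<open>bs i\<close>, \<open>cs i\<close> for \<open>i \<le> D\<close> are determined by \<open>G\<close>, so the quantifier over
  \<open>bs\<close> and \<open>cs\<close> only names them. For \<open>i = 0\<close> the term with \<open>i - 1\<close> is multiplied by
  \<open>gauss_bracket b 0 = 0\<close>.
\<close>

definition classical_parameters ::
  "('a, 'b) pre_digraph \<Rightarrow> nat \<Rightarrow> int \<Rightarrow> real \<Rightarrow> real \<Rightarrow> bool" where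
  "classical_parameters G D b \<alpha> \<beta> \<longleftrightarrow>
    distance_regular G \<and> diameter G = D \<and>
    (\<exists>bs cs. intersection_numbers G bs cs \<and>
      (\<forall>i \<le> D.
        real_of_int (cs i) =
          gauss_bracket b i * (1 + \<alpha> * gauss_bracket b (i - 1)) \<and>
        real_of_int (bs i) =
          (gauss_bracket b D - gauss_bracket b i) * (\<beta> - \<alpha> * gauss_bracket b i)))"

end

theory Submission
  imports Defs
begin

text \<open>
  Write \<open>[i]\<close> for the Gaussian bracket, \<open>m = b + 1\<close>, \<open>a = a\<^sub>1\<close> and \<open>c = c\<^sub>2 = m (1 + \<alpha>)\<close>. By
  Terwilliger's bound every local graph is an \<open>a\<close>-regular graph with least eigenvalue at least
  \<open>-m\<close>. Testing this against a vertex and its neighbourhood shows that every neighbourhood in a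
  local graph has average degree at least \<open>a / m - m\<close>. Nonadjacent vertices have at most \<open>c\<close> common
  neighbours, and \<open>a\<close> is much larger than \<open>c\<close> because \<open>D\<close> is large; hence local graphs contain
  cliques of size about \<open>a / m\<close>. Take a maximal clique \<open>F\<close> of size \<open>p\<close> at least that large. It has
  \<open>p \<le> \<beta>\<close> by Delsarte's bound, and testing the eigenvalue bound against \<open>F\<close> and an outside vertex
  shows that this vertex has at most about \<open>m (m - 1)\<close> neighbours in \<open>F\<close>. Counting the edges leaving
  \<open>F\<close> gives \<open>p (a + 1 - p) \<le> m (m - 1) \<beta> [D]\<close> up to a small error, which is impossible if
  \<open>\<alpha> \<ge> b\<^sup>2 (b + 1) + 1\<close>, since \<open>a + 1 = \<beta> + b \<alpha> [D - 1]\<close> and \<open>\<beta> > \<alpha> [D - 1]\<close>.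
\<close>

section \<open>Eigenvalue kernels of distance-regular graphs\<close>

lemma sum_of_bool_real:
  "finite A \<Longrightarrow> (\<Sum>x\<in>A. of_bool (P x)) = real (card {x \<in> A. P x})"
  by (simp add: sum_of_bool_eq Int_def)

text \<open>A distance-regular graph reduced to vertices, adjacency and distance, free of arcs and
  walks. \<open>b\<close> and \<open>c\<close> are real-valued because they enter eigenvalue
  equations.\<close>

locale metric_scheme =
  fixes V :: "'a set" and adj :: "'a \<Rightarrow> 'a \<Rightarrow> bool" and d :: "'a \<Rightarrow> 'a \<Rightarrow> nat"
    and D :: nat and b c :: "nat \<Rightarrow> real"
  assumes finite_V: "finite V"
    and dist_0: "x \<in> V \<Longrightarrow> y \<in> V \<Longrightarrow> d x y = 0 \<longleftrightarrow> x = y"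
    and dist_1: "x \<in> V \<Longrightarrow> y \<in> V \<Longrightarrow> d x y = 1 \<longleftrightarrow> adj x y"
    and dist_sym: "x \<in> V \<Longrightarrow> y \<in> V \<Longrightarrow> d x y = d y x"
    and dist_step: "x \<in> V \<Longrightarrow> y \<in> V \<Longrightarrow> z \<in> V \<Longrightarrow> adj y z \<Longrightarrow> d x z \<le> Suc (d x y)"
    and dist_le: "x \<in> V \<Longrightarrow> y \<in> V \<Longrightarrow> d x y \<le> D"
    and diameter_attained: "\<exists>x\<in>V. \<exists>y\<in>V. d x y = D"
    and card_c: "x \<in> V \<Longrightarrow> y \<in> V \<Longrightarrow>
      real (card {z \<in> V. adj y z \<and> Suc (d x z) = d x y}) = c (d x y)"
    and card_b: "x \<in> V \<Longrightarrow> y \<in> V \<Longrightarrow>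
      real (card {z \<in> V. adj y z \<and> d x z = Suc (d x y)}) = b (d x y)"
begin

section \<open>Intersection numbers and the three-term recurrence\<close>

abbreviation (input) a :: "nat \<Rightarrow> real" where
  "a i \<equiv> b 0 - b i - c i"

lemma dist_self: "x \<in> V \<Longrightarrow> d x x = 0"
  by (simp add: dist_0)

lemma adj_sym: "x \<in> V \<Longrightarrow> y \<in> V \<Longrightarrow> adj x y \<longleftrightarrow> adj y x"
  using dist_1[of x y] dist_1[of y x] dist_sym[of x y] by simp

lemma not_adj_self: "x \<in> V \<Longrightarrow> \<not> adj x x"
  using dist_1[of x x] dist_self[of x] by simp

lemma degree: "y \<in> V \<Longrightarrow> real (card {z \<in> V. adj y z}) = b 0"
proof -
  assume y: "y \<in> V"
  have "{z \<in> V. adj y z} = {z \<in> V. adj y z \<and> d y z = Suc (d y y)}"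
    using y dist_1[of y] dist_self[of y] by auto
  then show ?thesis using card_b[of y y] y dist_self[of y] by simp
qed

lemma dist_neighbour_cases:
  assumes "x \<in> V" "y \<in> V" "z \<in> V" "adj y z"
  obtains "Suc (d x z) = d x y" | "d x z = d x y" | "d x z = Suc (d x y)"
proof -
  have "d x z \<le> Suc (d x y)" "d x y \<le> Suc (d x z)"
    using assms dist_step adj_sym by auto
  then show thesis using that by linarith
qed

lemma card_a:
  assumes "x \<in> V" "y \<in> V"
  shows "real (card {z \<in> V. adj y z \<and> d x z = d x y}) = a (d x y)"
proof -
  let ?C = "{z \<in> V. adj y z \<and> Suc (d x z) = d x y}"
  let ?B = "{z \<in> V. adj y z \<and> d x z = Suc (d x y)}"
  let ?A = "{z \<in> V. adj y z \<and> d x z = d x y}"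
  have "{z \<in> V. adj y z} = (?C \<union> ?A) \<union> ?B"
    using assms by (auto elim: dist_neighbour_cases)
  moreover have "card ((?C \<union> ?A) \<union> ?B) = card (?C \<union> ?A) + card ?B"
    using finite_V by (intro card_Un_disjoint) auto
  moreover have "card (?C \<union> ?A) = card ?C + card ?A"
    using finite_V by (intro card_Un_disjoint) auto
  ultimately show ?thesis
    using degree[of y] card_c[of x y] card_b[of x y] assms by simp
qed

lemma c_0: "c 0 = 0"
proof -
  obtain x where x: "x \<in> V" using diameter_attained by blast
  then show ?thesis using card_c[of x x] dist_self[of x] by simp
qed

text \<open>The adjacency matrix maps functions of the distance from \<open>x\<close> to such
  functions, so eigenvectors of this kind amount to solutions of a three-term recurrence.\<close>

lemma neighbour_sum:
  assumes "x \<in> V" "y \<in> V" "d x y = i"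
  shows "(\<Sum>z\<in>V. of_bool (adj y z) * w (d x z))
    = c i * w (i - 1) + a i * w i + b i * w (Suc i)"
proof -
  have "of_bool (adj y z) * w (d x z) =
      of_bool (adj y z \<and> Suc (d x z) = i) * w (i - 1) + of_bool (adj y z \<and> d x z = i) * w i
      + of_bool (adj y z \<and> d x z = Suc i) * w (Suc i)" if z: "z \<in> V" for z
  proof (cases "adj y z")
    case True
    consider "i = Suc (d x z)" | "d x z = i" | "d x z = Suc i"
      using dist_neighbour_cases[OF assms(1,2) z True] assms(3) by metis
    then show ?thesis using True by cases auto
  qed simp
  then have "(\<Sum>z\<in>V. of_bool (adj y z) * w (d x z)) =
      (\<Sum>z\<in>V. of_bool (adj y z \<and> Suc (d x z) = i)) * w (i - 1)
      + (\<Sum>z\<in>V. of_bool (adj y z \<and> d x z = i)) * w i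
      + (\<Sum>z\<in>V. of_bool (adj y z \<and> d x z = Suc i)) * w (Suc i)"
    by (simp add: sum.distrib sum_distrib_right)
  then show ?thesis
    using card_a[of x y] card_b[of x y] card_c[of x y] assms finite_V
    by (simp only: sum_of_bool_real)
qed

text \<open>The distance matrices satisfy A A_i = c_(i+1) A_(i+1) + a_i A_i + b_(i-1) A_(i-1). Since
  \<open>c (Suc i)\<close> is nonzero, A_(i+1) can be solved for, so an eigenvector of A is one of
  every A_j.\<close>

lemma distance_sum_eigenvector:
  assumes eig: "\<And>i. i \<le> D \<Longrightarrow> c i * w (i - 1) + a i * w i + b i * w (Suc i) = \<theta> * w i"
    and c_pos: "\<And>i. 0 < i \<Longrightarrow> i \<le> D \<Longrightarrow> c i > 0"
    and "j \<le> D"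
  shows "\<exists>v. \<forall>x\<in>V. \<forall>y\<in>V. (\<Sum>z\<in>V. of_bool (d y z = j) * w (d x z)) = v * w (d x y)"
  using \<open>j \<le> D\<close>
proof (induction j rule: less_induct)
  case (less j)
  show ?case
  proof (cases j)
    case 0
    have "(\<Sum>z\<in>V. of_bool (d y z = j) * w (d x z)) = 1 * w (d x y)"
      if "x \<in> V" "y \<in> V" for x y
    proof -
      have "(\<Sum>z\<in>V. of_bool (d y z = j) * w (d x z)) = (\<Sum>z\<in>V. if y = z then w (d x z) else 0)"
        using that 0 dist_0 by (intro sum.cong) auto
      then show ?thesis using that finite_V by simp
    qed
    then show ?thesis by blast
  next
    case (Suc i)
    define P where "P j x y = (\<Sum>z\<in>V. of_bool (d y z = j) * w (d x z))" for j x y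
    obtain v where v: "\<And>x y. x \<in> V \<Longrightarrow> y \<in> V \<Longrightarrow> P i x y = v * w (d x y)"
      using less.IH[of i] less.prems Suc unfolding P_def by auto
    \<comment> \<open>The factor \<open>of_bool (i > 0)\<close> removes the term with A_(i-1) for
      \<open>i = 0\<close>, where \<open>i - 1\<close> truncates to 0.\<close>
    obtain v' where v': "\<And>x y. x \<in> V \<Longrightarrow> y \<in> V \<Longrightarrow>
        of_bool (i > 0) * b (i - 1) * P (i - 1) x y = v' * w (d x y)"
    proof (cases "i = 0")
      case True
      then show ?thesis using that[of 0] by simp
    next
      case False
      then have "i - 1 < j" "i - 1 \<le> D" using less.prems Suc by auto
      then obtain v'' where "\<forall>x\<in>V. \<forall>y\<in>V. P (i - 1) x y = v'' * w (d x y)"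
        using less.IH[of "i - 1"] unfolding P_def by blast
      then show ?thesis using that[of "b (i - 1) * v''"] False by simp
    qed
    have step: "c (Suc i) * P (Suc i) x y = (v * \<theta> - a i * v - v') * w (d x y)"
      if xy: "x \<in> V" "y \<in> V" for x y
    proof -
      \<comment> \<open>The (y,z) entry of A A_i, obtained by viewing the neighbours of
        \<open>y\<close> from \<open>z\<close>.\<close>
      have count: "(\<Sum>u\<in>V. of_bool (adj y u) * of_bool (d u z = i)) =
          c (Suc i) * of_bool (d y z = Suc i) + a i * of_bool (d y z = i)
          + of_bool (i > 0) * b (i - 1) * of_bool (d y z = i - 1)" if "z \<in> V" for z
      proof -
        have "(\<Sum>u\<in>V. of_bool (adj y u) * of_bool (d u z = i)) =
            (\<Sum>u\<in>V. of_bool (adj y u) * (of_bool (d z u = i) :: real))"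
          using that dist_sym by (intro sum.cong) auto
        \<comment> \<open>The condition \<open>d z y - 1 = i\<close> also holds for
          \<open>d z y = 0\<close> and \<open>i = 0\<close>; there \<open>c 0 = 0\<close> cancels
          the spurious term.\<close>
        also have "\<dots> = c (d z y) * of_bool (d z y - 1 = i) + a (d z y) * of_bool (d z y = i)
            + b (d z y) * of_bool (Suc (d z y) = i)"
          using neighbour_sum[OF that xy(2) refl, of "\<lambda>m. of_bool (m = i)"] by simp
        also have "\<dots> = c (Suc i) * of_bool (d y z = Suc i) + a i * of_bool (d y z = i)
            + of_bool (i > 0) * b (i - 1) * of_bool (d y z = i - 1)"
          using dist_sym[OF that xy(2)] c_0 by (cases "d z y"; cases i) (auto intro: gr0I)
        finally show ?thesis .
      qed
      have "(\<Sum>u\<in>V. of_bool (adj y u) * P i x u)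
          = (\<Sum>u\<in>V. of_bool (adj y u) * (v * w (d x u)))"
        using xy v by simp
      also have "\<dots> = v * (\<Sum>u\<in>V. of_bool (adj y u) * w (d x u))"
        by (simp add: sum_distrib_left mult.left_commute)
      also have "\<dots> = v * (\<theta> * w (d x y))"
        using neighbour_sum[OF xy refl] eig[OF dist_le[OF xy]] by simp
      finally have lhs: "(\<Sum>u\<in>V. of_bool (adj y u) * P i x u) = v * \<theta> * w (d x y)" by simp
      have "(\<Sum>u\<in>V. of_bool (adj y u) * P i x u)
          = (\<Sum>z\<in>V. \<Sum>u\<in>V. of_bool (adj y u) * of_bool (d u z = i) * w (d x z))"
        unfolding P_def sum_distrib_left by (subst sum.swap) (simp add: mult.assoc)
      also have "\<dots> = (\<Sum>z\<in>V. (c (Suc i) * of_bool (d y z = Suc i) + a i * of_bool (d y z = i)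
          + of_bool (i > 0) * b (i - 1) * of_bool (d y z = i - 1)) * w (d x z))"
        by (intro sum.cong refl) (simp only: sum_distrib_right[symmetric] count)
      also have "\<dots> = c (Suc i) * P (Suc i) x y + a i * P i x y
          + of_bool (i > 0) * b (i - 1) * P (i - 1) x y"
        unfolding P_def sum_distrib_left sum.distrib[symmetric]
        by (intro sum.cong) (simp_all add: algebra_simps)
      finally show ?thesis
        using lhs v[OF xy] v'[OF xy] by (simp add: algebra_simps)
    qed
    have "c (Suc i) > 0" using c_pos[of "Suc i"] less.prems Suc by simp
    then have "P (Suc i) x y = (v * \<theta> - a i * v - v') / c (Suc i) * w (d x y)"
      if "x \<in> V" "y \<in> V" for x y
      using step[OF that] by (simp add: field_simps)
    then show ?thesis unfolding P_def Suc by blast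
  qed
qed

text \<open>The kernel \<open>K(x,y) = w (d x y)\<close> satisfies \<open>K\<^sup>2 = \<kappa> K\<close> with \<open>\<kappa> > 0\<close>.\<close>

lemma eigenkernel_nonneg:
  assumes eig: "\<And>i. i \<le> D \<Longrightarrow> c i * w (i - 1) + a i * w i + b i * w (Suc i) = \<theta> * w i"
    and c_pos: "\<And>i. 0 < i \<Longrightarrow> i \<le> D \<Longrightarrow> c i > 0"
    and w0: "w 0 > 0"
  shows "0 \<le> (\<Sum>x\<in>V. \<Sum>y\<in>V. f x * f y * w (d x y))"
proof -
  obtain v where v: "\<And>j x y. j \<le> D \<Longrightarrow> x \<in> V \<Longrightarrow> y \<in> V \<Longrightarrow>
      (\<Sum>z\<in>V. of_bool (d y z = j) * w (d x z)) = v j * w (d x y)"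
    using distance_sum_eigenvector[OF eig c_pos] by metis
  define \<kappa> where "\<kappa> = (\<Sum>j\<le>D. w j * v j)"
  have square: "(\<Sum>z\<in>V. w (d x z) * w (d y z)) = \<kappa> * w (d x y)" if xy: "x \<in> V" "y \<in> V" for x y
  proof -
    have "(\<Sum>z\<in>V. w (d x z) * w (d y z))
        = (\<Sum>z\<in>V. \<Sum>j\<le>D. w j * (of_bool (d y z = j) * w (d x z)))"
    proof (intro sum.cong refl)
      fix z assume z: "z \<in> V"
      have "(\<Sum>j\<le>D. w j * (of_bool (d y z = j) * w (d x z)))
          = (\<Sum>j\<le>D. if d y z = j then w j * w (d x z) else 0)"
        by (intro sum.cong) auto
      then show "w (d x z) * w (d y z) = (\<Sum>j\<le>D. w j * (of_bool (d y z = j) * w (d x z)))"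
        using dist_le[OF xy(2) z] by simp
    qed
    also have "\<dots> = (\<Sum>j\<le>D. w j * (\<Sum>z\<in>V. of_bool (d y z = j) * w (d x z)))"
      by (subst sum.swap) (simp add: sum_distrib_left)
    also have "\<dots> = (\<Sum>j\<le>D. w j * v j * w (d x y))"
      using v xy by (simp add: mult.assoc)
    finally show ?thesis unfolding \<kappa>_def by (simp add: sum_distrib_right)
  qed
  \<comment> \<open>A diagonal entry of K squared contains the square of \<open>w 0\<close>, which
    forces \<open>\<kappa>\<close> to be positive.\<close>
  obtain x0 where x0: "x0 \<in> V" using diameter_attained by blast
  have "w (d x0 x0) * w (d x0 x0) \<le> (\<Sum>z\<in>V. w (d x0 z) * w (d x0 z))"
    using x0 finite_V by (intro member_le_sum) auto
  then have "w 0 * w 0 \<le> \<kappa> * w 0"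
    using square[OF x0 x0] dist_self[OF x0] by simp
  then have \<kappa>: "\<kappa> > 0" using w0 by (simp add: less_le_trans)
  have "0 \<le> (\<Sum>z\<in>V. (\<Sum>x\<in>V. f x * w (d x z))\<^sup>2)"
    by (intro sum_nonneg) auto
  also have "\<dots> = (\<Sum>z\<in>V. \<Sum>x\<in>V. \<Sum>y\<in>V. f x * f y * (w (d x z) * w (d y z)))"
    unfolding power2_eq_square sum_product by (simp add: mult_ac)
  also have "\<dots> = (\<Sum>x\<in>V. \<Sum>z\<in>V. \<Sum>y\<in>V. f x * f y * (w (d x z) * w (d y z)))"
    by (rule sum.swap)
  also have "\<dots> = (\<Sum>x\<in>V. \<Sum>y\<in>V. \<Sum>z\<in>V. f x * f y * (w (d x z) * w (d y z)))"
    by (intro sum.cong refl sum.swap)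
  also have "\<dots> = (\<Sum>x\<in>V. \<Sum>y\<in>V. f x * f y * (\<kappa> * w (d x y)))"
    using square by (simp flip: sum_distrib_left)
  also have "\<dots> = \<kappa> * (\<Sum>x\<in>V. \<Sum>y\<in>V. f x * f y * w (d x y))"
    by (simp add: sum_distrib_left mult_ac)
  finally show ?thesis using \<kappa> by (simp add: zero_le_mult_iff)
qed

end

section \<open>Cliques in regular graphs with bounded least eigenvalue\<close>

text \<open>Models a local graph. The eigenvalue bound says that A + m I is positive semidefinite;
  \<open>\<mu>\<close> will be \<open>c 2\<close>, \<open>k\<close> the number \<open>a 1\<close>,
  and \<open>m\<close> the classical parameter plus 1.\<close>

locale bounded_eigenvalue_graph =
  fixes W :: "'a set" and adj :: "'a \<Rightarrow> 'a \<Rightarrow> bool" and m \<mu> :: real and k :: nat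
  assumes finite_W: "finite W"
    and sym: "u \<in> W \<Longrightarrow> v \<in> W \<Longrightarrow> adj u v \<longleftrightarrow> adj v u"
    and irrefl: "u \<in> W \<Longrightarrow> \<not> adj u u"
    and m_gt_1: "m > 1" and mu_nonneg: "\<mu> \<ge> 0"
    and eigenvalue_bound:
      "0 \<le> (\<Sum>u\<in>W. \<Sum>v\<in>W. f u * f v * (of_bool (adj u v) + m * of_bool (u = v)))"
    and regular: "u \<in> W \<Longrightarrow> card {v \<in> W. adj u v} = k"
    and common_neighbours: "u \<in> W \<Longrightarrow> v \<in> W \<Longrightarrow> u \<noteq> v \<Longrightarrow> \<not> adj u v \<Longrightarrow>
      real (card {z \<in> W. adj u z \<and> adj v z}) \<le> \<mu>"
begin

section \<open>Cliques and test vectors for the eigenvalue bound\<close>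

definition clique :: "'a set \<Rightarrow> bool" where
  "clique S \<longleftrightarrow> S \<subseteq> W \<and> (\<forall>u\<in>S. \<forall>v\<in>S. u \<noteq> v \<longrightarrow> adj u v)"

text \<open>The eigenvalue bound for the vector that is 1 at \<open>y\<close>, \<open>g\<close> on
  \<open>F\<close> and 0 elsewhere; symmetry doubles the cross terms.\<close>

lemma quadratic_form_vertex:
  assumes y: "y \<in> W" "y \<notin> F" and F: "F \<subseteq> W"
  shows "0 \<le> m + 2 * (\<Sum>u\<in>F. g u * of_bool (adj y u))
    + (\<Sum>u\<in>F. \<Sum>v\<in>F. g u * g v * (of_bool (adj u v) + m * of_bool (u = v)))"
proof -
  define f where "f u = (if u = y then 1 else if u \<in> F then g u else 0)" for u
  define B where "B u v = of_bool (adj u v) + m * of_bool (u = v)" for u v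
  have fin: "finite F" using F finite_W finite_subset by blast
  have f: "f y = 1" "\<And>u. u \<in> F \<Longrightarrow> f u = g u" "\<And>u. u \<notin> insert y F \<Longrightarrow> f u = 0"
    using y by (auto simp: f_def)
  have B: "B y y = m" "\<And>u. u \<in> F \<Longrightarrow> B y u = of_bool (adj y u)"
    "\<And>u. u \<in> F \<Longrightarrow> B u y = of_bool (adj y u)"
    using y F irrefl sym by (auto simp: B_def)
  have restrict: "(\<Sum>u\<in>W. f u * h u) = h y + (\<Sum>u\<in>F. g u * h u)" for h
  proof -
    have "(\<Sum>u\<in>W. f u * h u) = (\<Sum>u\<in>insert y F. f u * h u)"
      using y F finite_W f(3) by (intro sum.mono_neutral_right) auto
    then show ?thesis using y fin f by simp
  qed
  have "(\<Sum>u\<in>W. \<Sum>v\<in>W. f u * f v * B u v) = (\<Sum>u\<in>W. f u * (\<Sum>v\<in>W. f v * B u v))"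
    by (simp add: sum_distrib_left mult.assoc)
  also have "\<dots> = (B y y + (\<Sum>v\<in>F. g v * B y v)) + (\<Sum>u\<in>F. g u * (B u y + (\<Sum>v\<in>F. g v * B u v)))"
    by (simp only: restrict)
  also have "\<dots> = m + 2 * (\<Sum>u\<in>F. g u * of_bool (adj y u)) + (\<Sum>u\<in>F. \<Sum>v\<in>F. g u * g v * B u v)"
    using B by (simp add: distrib_left sum.distrib sum_distrib_left mult.assoc)
  finally have eq: "(\<Sum>u\<in>W. \<Sum>v\<in>W. f u * f v * B u v) = \<dots>" .
  show ?thesis
    using eigenvalue_bound[of f] unfolding B_def[symmetric] eq .
qed

text \<open>Test vector: 1 at \<open>y\<close> and a constant on its neighbourhood. The double sum
  counts ordered pairs, so the average degree inside \<open>H\<close> is at least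
  \<open>k / m - m\<close>.\<close>

lemma edges_in_neighbourhood:
  assumes y: "y \<in> W" and H: "H = {u \<in> W. adj y u}" and "k > 0"
  shows "(\<Sum>u\<in>H. \<Sum>v\<in>H. of_bool (adj u v)) \<ge> real k * (real k / m - m)"
proof -
  define e where "e = (\<Sum>u\<in>H. \<Sum>v\<in>H. of_bool (adj u v) :: real)"
  have HW: "H \<subseteq> W" and yH: "y \<notin> H" and card_H: "card H = k"
    using y H irrefl regular by auto
  have fin: "finite H" using HW finite_W finite_subset by blast
  have "e \<ge> 0" unfolding e_def by (intro sum_nonneg) auto
  then have pos: "e + m * k > 0" using m_gt_1 \<open>k > 0\<close> by (simp add: add_nonneg_pos)
  \<comment> \<open>The minimiser of m - 2 t k + t^2 (e + m k), with minimum m - k^2 / (e + m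
    k).\<close>
  define t where "t = k / (e + m * k)"
  have s1: "(\<Sum>u\<in>H. (- t) * of_bool (adj y u)) = - t * k"
    using H card_H by simp
  have "(\<Sum>u\<in>H. \<Sum>v\<in>H. (- t) * (- t) * (of_bool (adj u v) + m * of_bool (u = v)))
      = t * t * (\<Sum>u\<in>H. (\<Sum>v\<in>H. of_bool (adj u v)) + m * (\<Sum>v\<in>H. of_bool (u = v)))"
    by (simp add: sum_distrib_left sum.distrib distrib_left mult_ac)
  also have "\<dots> = t * t * (\<Sum>u\<in>H. (\<Sum>v\<in>H. of_bool (adj u v)) + m)"
  proof -
    have "(\<Sum>v\<in>H. of_bool (u = v)) = (1 :: real)" if "u \<in> H" for u
      using that fin by (simp add: of_bool_def)
    then show ?thesis by simp
  qed
  also have "\<dots> = t * t * (e + m * k)"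
    using card_H by (simp add: sum.distrib e_def mult.commute)
  finally have "0 \<le> m + 2 * (- t * k) + t * t * (e + m * k)"
    using quadratic_form_vertex[OF y yH HW, of "\<lambda>_. - t"] s1 by simp
  also have "\<dots> = m - k * k / (e + m * k)"
    using pos unfolding t_def by (simp add: divide_simps)
  finally have "k * k \<le> m * (e + m * k)"
    using pos by (simp add: divide_simps)
  then show ?thesis
    using m_gt_1 unfolding e_def[symmetric] by (simp add: field_simps)
qed

text \<open>On a clique A + m I equals J + (m - 1) I, which can be inverted explicitly; minimising
  the form over the values on \<open>F\<close> gives the inequality. It excludes a middle range of
  \<open>l\<close> when \<open>F\<close> is large.\<close>

lemma clique_neighbours:
  assumes F: "clique F" and y: "y \<in> W" "y \<notin> F" and l: "l = real (card {u \<in> F. adj y u})"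
  shows "l * (card F + m - 1 - l) \<le> m * (m - 1) * (card F + m - 1)"
proof -
  define p where "p = real (card F)"
  define q where "q = p + m - 1"
  define t where "t = l / q"
  have FW: "F \<subseteq> W" using F clique_def by auto
  then have fin: "finite F" using finite_W finite_subset by blast
  have q: "q > 0" using m_gt_1 by (simp add: q_def p_def)
  have m1: "m - 1 > 0" using m_gt_1 by simp
  \<comment> \<open>The minimiser: \<open>g\<close> solves (J + (m - 1) I) g = -1_N for the set N of
    neighbours of \<open>y\<close> in \<open>F\<close>. Summing this equation shows that
    \<open>g\<close> has total \<open>- t\<close>.\<close>
  define g where "g u = (t - of_bool (adj y u)) / (m - 1)" for u
  have sl: "(\<Sum>u\<in>F. of_bool (adj y u)) = l"
    using l fin by (simp add: sum_of_bool_real del: sum_of_bool_eq)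
  have sg: "(\<Sum>u\<in>F. g u) = - t"
  proof -
    have "(\<Sum>u\<in>F. g u) = (t * p - l) / (m - 1)"
      using sl unfolding g_def by (simp add: sum_divide_distrib[symmetric] sum_subtractf p_def)
    also have "t * p - l = - t * (m - 1)"
      using q unfolding t_def q_def by (simp add: field_simps)
    finally show ?thesis using m1 by simp
  qed
  have sga: "(\<Sum>u\<in>F. g u * of_bool (adj y u)) = (t - 1) * l / (m - 1)"
  proof -
    have "(\<Sum>u\<in>F. g u * of_bool (adj y u)) = (\<Sum>u\<in>F. (t - 1) / (m - 1) * of_bool (adj y u))"
      by (intro sum.cong) (auto simp: g_def)
    then show ?thesis using sl by (simp only: sum_distrib_left[symmetric]) simp
  qed
  have sgg: "(\<Sum>u\<in>F. g u * g u) = - t * t / (m - 1) - (t - 1) * l / (m - 1) / (m - 1)"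
  proof -
    have "(\<Sum>u\<in>F. g u * g u) = (\<Sum>u\<in>F. t / (m - 1) * g u - g u * of_bool (adj y u) / (m - 1))"
      by (intro sum.cong) (auto simp: g_def diff_divide_distrib algebra_simps)
    also have "\<dots> = t / (m - 1) * (\<Sum>u\<in>F. g u) - (\<Sum>u\<in>F. g u * of_bool (adj y u)) / (m - 1)"
      by (simp add: sum_subtractf sum_distrib_left sum_divide_distrib)
    finally show ?thesis unfolding sg sga by simp
  qed
  have "(\<Sum>u\<in>F. \<Sum>v\<in>F. g u * g v * (of_bool (adj u v) + m * of_bool (u = v)))
      = (\<Sum>u\<in>F. \<Sum>v\<in>F. g u * g v + (if u = v then (m - 1) * (g u * g v) else 0))"
  proof (intro sum.cong refl)
    fix u v assume "u \<in> F" "v \<in> F"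
    then have "of_bool (adj u v) + m * of_bool (u = v) = (1 + (if u = v then m - 1 else 0))"
      using F irrefl unfolding clique_def by auto
    then show "g u * g v * (of_bool (adj u v) + m * of_bool (u = v))
        = g u * g v + (if u = v then (m - 1) * (g u * g v) else 0)"
      by (simp add: algebra_simps)
  qed
  also have "\<dots> = (\<Sum>u\<in>F. g u) * (\<Sum>u\<in>F. g u) + (m - 1) * (\<Sum>u\<in>F. g u * g u)"
    using fin by (simp add: sum.distrib sum_product) (simp add: sum_distrib_left)
  finally have "0 \<le> m + 2 * ((t - 1) * l / (m - 1))
      + ((- t) * (- t) + (m - 1) * (- t * t / (m - 1) - (t - 1) * l / (m - 1) / (m - 1)))"
    using quadratic_form_vertex[OF y FW, of g] unfolding sg sga sgg by simp
  also have "\<dots> = m - l * (1 - t) / (m - 1)"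
    using m1 by (simp add: divide_simps) (simp add: algebra_simps)
  finally have "l * (1 - t) \<le> m * (m - 1)"
    using m1 by (simp add: pos_divide_le_eq)
  then have "l * (1 - t) * q \<le> m * (m - 1) * q"
    using q by (intro mult_right_mono) auto
  moreover have "(1 - t) * q = q - l"
    using q by (simp add: t_def field_simps)
  ultimately show ?thesis unfolding q_def p_def by (metis mult.assoc)
qed

section \<open>Large cliques in the neighbourhood of a vertex\<close>

text \<open>
  \<open>Y w\<close> counts the nonadjacent pairs among the common neighbours of \<open>y\<close> and \<open>w\<close>. Averaging
  \<open>card (N w) - 4 m Y w / k\<close> over \<open>w\<close> yields a \<open>w\<close> for which \<open>N w\<close> is large and nearly a clique.
\<close>

lemma dense_neighbourhood:
  assumes y: "y \<in> W" and H: "H = {u \<in> W. adj y u}" and k: "k > 0"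
    and N: "N = (\<lambda>w. {u \<in> H. adj w u})"
    and Y: "Y = (\<lambda>w. \<Sum>u\<in>N w. \<Sum>v\<in>N w. of_bool (u \<noteq> v \<and> \<not> adj u v))"
  shows "\<exists>w\<in>H. real (card (N w)) - 4 * m / k * Y w \<ge> k / m - m - 4 * m * \<mu>"
proof (rule ccontr)
  have HW: "H \<subseteq> W" and card_H: "card H = k"
    using y H regular by auto
  have fin: "finite H" using HW finite_W finite_subset by blast
  have "(\<Sum>w\<in>H. real (card (N w))) = (\<Sum>u\<in>H. \<Sum>v\<in>H. of_bool (adj u v))"
    unfolding N using fin by (simp add: sum_of_bool_real del: sum_of_bool_eq)
  then have dN: "(\<Sum>w\<in>H. real (card (N w))) \<ge> k * (k / m - m)"
    using edges_in_neighbourhood[OF y H k] by simp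
  have Y_expand: "Y w = (\<Sum>u\<in>H. \<Sum>v\<in>H. of_bool (u \<noteq> v \<and> \<not> adj u v) * of_bool (adj w u \<and> adj w v))"
    if "w \<in> H" for w
  proof -
    have "(\<Sum>u\<in>N w. \<Sum>v\<in>N w. of_bool (u \<noteq> v \<and> \<not> adj u v))
        = (\<Sum>u\<in>H. if adj w u then (\<Sum>v\<in>H. if adj w v then of_bool (u \<noteq> v \<and> \<not> adj u v) else 0) else (0 :: real))"
      unfolding N using fin by (simp add: sum.inter_filter del: sum_of_bool_eq)
    also have "\<dots> = (\<Sum>u\<in>H. \<Sum>v\<in>H. of_bool (u \<noteq> v \<and> \<not> adj u v) * of_bool (adj w u \<and> adj w v))"
      by (auto intro!: sum.cong)
    finally show ?thesis unfolding Y .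
  qed
  have "(\<Sum>w\<in>H. Y w) = (\<Sum>u\<in>H. \<Sum>v\<in>H. \<Sum>w\<in>H. of_bool (u \<noteq> v \<and> \<not> adj u v) * of_bool (adj w u \<and> adj w v))"
  proof -
    have "(\<Sum>w\<in>H. Y w) = (\<Sum>w\<in>H. \<Sum>u\<in>H. \<Sum>v\<in>H. of_bool (u \<noteq> v \<and> \<not> adj u v) * of_bool (adj w u \<and> adj w v))"
      using Y_expand by simp
    also have "\<dots> = (\<Sum>u\<in>H. \<Sum>w\<in>H. \<Sum>v\<in>H. of_bool (u \<noteq> v \<and> \<not> adj u v) * of_bool (adj w u \<and> adj w v))"
      by (rule sum.swap)
    also have "\<dots> = (\<Sum>u\<in>H. \<Sum>v\<in>H. \<Sum>w\<in>H. of_bool (u \<noteq> v \<and> \<not> adj u v) * of_bool (adj w u \<and> adj w v))"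
      by (intro sum.cong refl sum.swap)
    finally show ?thesis .
  qed
  \<comment> \<open>A nonadjacent pair lies in \<open>N w\<close> only if \<open>w\<close> is a
    common neighbour, hence for at most \<open>\<mu>\<close> choices of \<open>w\<close>.\<close>
  also have "\<dots> \<le> (\<Sum>u\<in>H. \<Sum>v\<in>H. \<mu>)"
  proof (intro sum_mono)
    fix u v assume uv: "u \<in> H" "v \<in> H"
    show "(\<Sum>w\<in>H. of_bool (u \<noteq> v \<and> \<not> adj u v) * of_bool (adj w u \<and> adj w v)) \<le> \<mu>"
    proof (cases "u \<noteq> v \<and> \<not> adj u v")
      case True
      have "card {w \<in> H. adj w u \<and> adj w v} \<le> card {z \<in> W. adj u z \<and> adj v z}"
        using uv HW finite_W sym by (intro card_mono) auto
      then show ?thesis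
        using True common_neighbours[of u v] uv HW fin
        by (simp add: sum_of_bool_real subset_iff del: sum_of_bool_eq)
    qed (use mu_nonneg in auto)
  qed
  finally have sY: "(\<Sum>w\<in>H. Y w) \<le> k * k * \<mu>"
    using card_H by simp
  assume "\<not> ?thesis"
  then have "(\<Sum>w\<in>H. real (card (N w)) - 4 * m / k * Y w) < (\<Sum>w\<in>H. k / m - m - 4 * m * \<mu>)"
    using fin card_H k by (intro sum_strict_mono) (auto simp: not_le)
  also have "\<dots> = k * (k / m - m) - 4 * m * k * \<mu>"
    using card_H by (simp add: algebra_simps)
  finally have "(\<Sum>w\<in>H. real (card (N w))) - 4 * m / k * (\<Sum>w\<in>H. Y w) < k * (k / m - m) - 4 * m * k * \<mu>"
    by (simp add: sum_subtractf sum_distrib_left)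
  moreover have "4 * m / k * (\<Sum>w\<in>H. Y w) \<le> 4 * m / k * (k * k * \<mu>)"
    using sY m_gt_1 by (intro mult_left_mono) auto
  moreover have "4 * m / k * (k * k * \<mu>) = 4 * m * k * \<mu>"
    using k by simp
  ultimately show False using dN by linarith
qed

text \<open>Within a dense \<open>N w\<close>, keep the vertices with fewer than
  \<open>(n - \<mu>) / 2\<close> non-neighbours. They form a clique, and each discarded vertex
  accounts for at least \<open>k / (4 * m)\<close> pairs in \<open>Y w\<close>. Hence at most
  \<open>4 * m / k * Y w\<close> vertices are lost, exactly the penalty subtracted in
  \<open>dense_neighbourhood\<close>.\<close>

lemma large_clique:
  assumes y: "y \<in> W" and k: "k > 0"
    and large: "k / (2 * m) \<ge> m + (4 * m + 1) * \<mu>"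
  shows "\<exists>G. clique G \<and> card G \<ge> k / m - m - 4 * m * \<mu>"
proof -
  define H where "H = {u \<in> W. adj y u}"
  define N where "N w = {u \<in> H. adj w u}" for w
  define Y where "Y w = (\<Sum>u\<in>N w. \<Sum>v\<in>N w. of_bool (u \<noteq> v \<and> \<not> adj u v) :: real)" for w
  obtain w where w: "w \<in> H"
    and card_N: "real (card (N w)) - 4 * m / k * Y w \<ge> k / m - m - 4 * m * \<mu>"
    using dense_neighbourhood[OF y H_def k, of N Y] N_def Y_def by blast
  define n where "n = real (card (N w))"
  define nd where "nd u = card {v \<in> N w. u \<noteq> v \<and> \<not> adj u v}" for u
  define G where "G = {u \<in> N w. 2 * real (nd u) < n - \<mu>}"
  have NW: "N w \<subseteq> W" by (auto simp: N_def H_def)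
  then have fin: "finite (N w)" using finite_W finite_subset by blast
  have Y_nd: "Y w = (\<Sum>u\<in>N w. real (nd u))"
    unfolding Y_def nd_def using fin by (simp add: sum_of_bool_real del: sum_of_bool_eq)
  have Y0: "Y w \<ge> 0" unfolding Y_nd by (intro sum_nonneg) auto
  have "4 * m / k * Y w \<ge> 0" using Y0 m_gt_1 by simp
  moreover have "k / (2 * m) + k / (2 * m) = k / m" using m_gt_1 by (simp add: field_simps)
  ultimately have n: "n - \<mu> \<ge> k / (2 * m)"
    using card_N large unfolding n_def by (simp add: algebra_simps)
  have "clique G"
    unfolding clique_def
  proof (intro conjI ballI impI)
    show "G \<subseteq> W" using NW G_def by auto
    fix u v assume uv: "u \<in> G" "v \<in> G" "u \<noteq> v"
    show "adj u v"
    proof (rule ccontr)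
      assume nadj: "\<not> adj u v"
      have uvN: "u \<in> N w" "v \<in> N w" "u \<in> W" "v \<in> W" using uv G_def NW by auto
      \<comment> \<open>Being nonadjacent, \<open>u\<close> and \<open>v\<close> themselves fall
        into the last two sets.\<close>
      have "N w \<subseteq> {z \<in> W. adj u z \<and> adj v z} \<union> {z \<in> N w. u \<noteq> z \<and> \<not> adj u z}
          \<union> {z \<in> N w. v \<noteq> z \<and> \<not> adj v z}"
        using uvN NW uv(3) nadj sym by auto
      then have "card (N w) \<le> card ({z \<in> W. adj u z \<and> adj v z} \<union> {z \<in> N w. u \<noteq> z \<and> \<not> adj u z}
          \<union> {z \<in> N w. v \<noteq> z \<and> \<not> adj v z})"
        using finite_W fin by (intro card_mono) auto
      also have "\<dots> \<le> card {z \<in> W. adj u z \<and> adj v z} + nd u + nd v"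
        unfolding nd_def by (meson add_le_mono1 card_Un_le le_trans)
      finally have "n \<le> real (card {z \<in> W. adj u z \<and> adj v z}) + nd u + nd v"
        unfolding n_def by linarith
      also have "\<dots> \<le> \<mu> + nd u + nd v"
        using common_neighbours[of u v] uvN uv(3) nadj by simp
      finally show False using uv unfolding G_def by auto
    qed
  qed
  have "real (card (N w - G)) * (n - \<mu>) = (\<Sum>u\<in>N w - G. n - \<mu>)" by simp
  also have "\<dots> \<le> (\<Sum>u\<in>N w - G. 2 * real (nd u))"
    by (intro sum_mono) (auto simp: G_def)
  also have "\<dots> \<le> (\<Sum>u\<in>N w. 2 * real (nd u))"
    using fin by (intro sum_mono2) auto
  also have "\<dots> = 2 * Y w" by (simp add: Y_nd sum_distrib_left)
  finally have "real (card (N w - G)) * (n - \<mu>) \<le> 2 * Y w" .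
  moreover have "real (card (N w - G)) * (k / (2 * m)) \<le> real (card (N w - G)) * (n - \<mu>)"
    using n by (intro mult_left_mono) auto
  ultimately have "real (card (N w - G)) * (k / (2 * m)) \<le> 2 * Y w" by linarith
  then have "real (card (N w - G)) \<le> 4 * m / k * Y w"
    using k m_gt_1 by (simp add: field_simps)
  moreover have "real (card (N w)) = real (card G) + real (card (N w - G))"
  proof -
    have "G \<subseteq> N w" by (auto simp: G_def)
    then show ?thesis
      using card_mono[OF fin \<open>G \<subseteq> N w\<close>] finite_subset[OF \<open>G \<subseteq> N w\<close> fin]
      by (simp add: card_Diff_subset)
  qed
  ultimately show ?thesis using card_N \<open>clique G\<close> by (intro exI[of _ G]) auto
qed

section \<open>Edges leaving a maximal clique\<close>

text \<open>Count the edges between \<open>F\<close> and its complement from both sides. Maximality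
  gives each outside vertex at most \<open>\<mu>\<close> neighbours in \<open>F\<close>, which
  selects the lower range allowed by \<open>clique_neighbours\<close>.\<close>

lemma maximal_clique_edge_count:
  assumes F: "clique F"
    and maximal: "\<And>F'. clique F' \<Longrightarrow> F \<subseteq> F' \<Longrightarrow> F' = F"
    and large: "card F + m - 1 > \<mu>"
  shows "card F * (k + 1 - real (card F)) * (card F + m - 1 - \<mu>)
    \<le> (card W - real (card F)) * (m * (m - 1) * (card F + m - 1))"
proof -
  define p where "p = real (card F)"
  have FW: "F \<subseteq> W" using F clique_def by auto
  then have fin: "finite F" using finite_W finite_subset by blast
  have outside: "real (card {u \<in> F. adj y u}) * (p + m - 1 - \<mu>) \<le> m * (m - 1) * (p + m - 1)"
    if y: "y \<in> W - F" for y
  proof -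
    define l where "l = real (card {u \<in> F. adj y u})"
    obtain w where w: "w \<in> F" "\<not> adj y w"
    proof -
      have "\<not> clique (insert y F)" using maximal[of "insert y F"] y by auto
      then show thesis using that F y sym FW unfolding clique_def by auto
    qed
    \<comment> \<open>As \<open>w\<close> is adjacent to the rest of the clique and not to
      \<open>y\<close>, all neighbours of \<open>y\<close> in \<open>F\<close> are common neighbours
      of \<open>y\<close> and \<open>w\<close>.\<close>
    have "card {u \<in> F. adj y u} \<le> card {z \<in> W. adj y z \<and> adj w z}"
      using w F FW finite_W by (intro card_mono) (auto simp: clique_def)
    then have "l \<le> \<mu>"
      using common_neighbours[of y w] w y FW unfolding l_def by fastforce
    then have "l * (p + m - 1 - \<mu>) \<le> l * (p + m - 1 - l)"
      by (intro mult_left_mono) (auto simp: l_def)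
    also have "\<dots> \<le> m * (m - 1) * (p + m - 1)"
      using clique_neighbours[OF F _ _ l_def] y unfolding p_def by auto
    finally show ?thesis unfolding l_def .
  qed
  have inside: "real (card {y \<in> W - F. adj y u}) = k + 1 - p" if u: "u \<in> F" for u
  proof -
    have "{v \<in> W. adj u v} = {y \<in> W - F. adj y u} \<union> (F - {u})"
      using u F FW sym irrefl unfolding clique_def by auto
    moreover have "card ({y \<in> W - F. adj y u} \<union> (F - {u})) = card {y \<in> W - F. adj y u} + card (F - {u})"
      using finite_W fin by (intro card_Un_disjoint) auto
    moreover have "card F \<ge> 1" using u fin by (metis Suc_leI One_nat_def card_gt_0_iff empty_iff)
    ultimately show ?thesis using regular[of u] u FW fin unfolding p_def by (auto simp: of_nat_diff)
  qed
  have "(\<Sum>y\<in>W - F. real (card {u \<in> F. adj y u})) = (\<Sum>y\<in>W - F. \<Sum>u\<in>F. of_bool (adj y u))"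
    using fin by (simp add: sum_of_bool_real del: sum_of_bool_eq)
  also have "\<dots> = (\<Sum>u\<in>F. \<Sum>y\<in>W - F. of_bool (adj y u))"
    by (rule sum.swap)
  also have "\<dots> = (\<Sum>u\<in>F. k + 1 - p)"
    using inside finite_W by (simp add: sum_of_bool_real del: sum_of_bool_eq)
  also have "\<dots> = p * (k + 1 - p)" by (simp add: p_def)
  finally have "p * (k + 1 - p) * (p + m - 1 - \<mu>)
      = (\<Sum>y\<in>W - F. real (card {u \<in> F. adj y u})) * (p + m - 1 - \<mu>)"
    by simp
  also have "\<dots> = (\<Sum>y\<in>W - F. real (card {u \<in> F. adj y u}) * (p + m - 1 - \<mu>))"
    by (rule sum_distrib_right)
  also have "\<dots> \<le> (\<Sum>y\<in>W - F. m * (m - 1) * (p + m - 1))"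
    by (intro sum_mono outside)
  also have "\<dots> = (card W - p) * (m * (m - 1) * (p + m - 1))"
    using fin FW card_mono[OF finite_W FW] by (simp add: p_def card_Diff_subset of_nat_diff)
  finally show ?thesis unfolding p_def .
qed

text \<open>Extending the large clique to a maximal one keeps its size bound and makes the edge
  count available.\<close>

lemma clique_size_inequality:
  assumes "W \<noteq> {}" "k > 0" and large: "k / (2 * m) \<ge> m + (4 * m + 1) * \<mu>"
    and "k / m - m - 4 * m * \<mu> > \<mu>"
  obtains F where "clique F" "card F \<ge> k / m - m - 4 * m * \<mu>"
    "card F * (k + 1 - real (card F)) * (card F + m - 1 - \<mu>)
      \<le> (card W - real (card F)) * (m * (m - 1) * (card F + m - 1))"
proof -
  obtain y where "y \<in> W" using assms by auto
  then obtain G where G: "clique G" "card G \<ge> k / m - m - 4 * m * \<mu>"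
    using large_clique[OF _ assms(2) large] by blast
  have "finite {F. clique F \<and> G \<subseteq> F}"
    by (rule finite_subset[of _ "Pow W"]) (auto simp: clique_def finite_W)
  moreover have "G \<in> {F. clique F \<and> G \<subseteq> F}" using G by simp
  ultimately have "\<exists>F\<in>{F. clique F \<and> G \<subseteq> F}. G \<le> F \<and>
      (\<forall>F'\<in>{F. clique F \<and> G \<subseteq> F}. F \<le> F' \<longrightarrow> F = F')"
    by (rule finite_has_maximal2)
  then obtain F where F: "clique F" "G \<subseteq> F"
    and maximal: "\<And>F'. clique F' \<Longrightarrow> G \<subseteq> F' \<Longrightarrow> F \<subseteq> F' \<Longrightarrow> F = F'"
    by auto
  have "finite F" using F finite_W finite_subset unfolding clique_def by blast
  then have "card G \<le> card F" using F by (intro card_mono) auto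
  then have size: "card F \<ge> k / m - m - 4 * m * \<mu>" using G by linarith
  show thesis
  proof (rule that[OF F(1) size maximal_clique_edge_count[OF F(1)]])
    show "\<And>F'. clique F' \<Longrightarrow> F \<subseteq> F' \<Longrightarrow> F' = F" using maximal F(2) by fastforce
    show "card F + m - 1 > \<mu>" using size assms m_gt_1 by linarith
  qed
qed

end

section \<open>Classical parameters\<close>

lemma gauss_bracket_0 [simp]: "gauss_bracket q 0 = 0"
  by (simp add: gauss_bracket_def)

lemma gauss_bracket_Suc: "gauss_bracket q (Suc i) = 1 + real_of_int q * gauss_bracket q i"
  unfolding gauss_bracket_def
  by (simp add: sum.lessThan_Suc_shift sum_distrib_left del: sum.lessThan_Suc)

text \<open>The geometric sum without division; it turns powers of \<open>q\<close> into brackets,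
  so that eigenvalue equations become polynomial identities.\<close>

lemma power_eq_gauss_bracket: "real_of_int q ^ i = 1 + (real_of_int q - 1) * gauss_bracket q i"
proof (induction i)
  case (Suc i)
  have "real_of_int q ^ Suc i = real_of_int q * (1 + (real_of_int q - 1) * gauss_bracket q i)"
    by (simp add: Suc)
  also have "\<dots> = 1 + (real_of_int q - 1) * gauss_bracket q (Suc i)"
    unfolding gauss_bracket_Suc by algebra
  finally show ?case .
qed simp

lemma gauss_bracket_nonneg: "q \<ge> 0 \<Longrightarrow> gauss_bracket q i \<ge> 0"
  unfolding gauss_bracket_def by (intro sum_nonneg) auto

lemma gauss_bracket_mono: "q \<ge> 0 \<Longrightarrow> i \<le> j \<Longrightarrow> gauss_bracket q i \<le> gauss_bracket q j"
  unfolding gauss_bracket_def by (intro sum_mono2) auto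

text \<open>The parameter b of the theorem is called \<open>q\<close> here, since \<open>b\<close>
  already names intersection numbers.\<close>

locale classical_scheme = metric_scheme V adj d D b c
  for V :: "'a set" and adj d D b c +
  fixes q :: int and \<alpha> \<beta> :: real
  assumes q_ge_2: "q \<ge> 2" and D_ge_2: "D \<ge> 2" and alpha_nonneg: "\<alpha> \<ge> 0"
    and c_eq: "i \<le> D \<Longrightarrow> c i = gauss_bracket q i * (1 + \<alpha> * gauss_bracket q (i - 1))"
    and b_eq: "i \<le> D \<Longrightarrow>
      b i = (gauss_bracket q D - gauss_bracket q i) * (\<beta> - \<alpha> * gauss_bracket q i)"
begin

section \<open>Basic consequences of classical parameters\<close>

abbreviation (input) r :: real where "r \<equiv> real_of_int q"
abbreviation (input) E :: real where "E \<equiv> gauss_bracket q (D - 1)"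

lemma r_ge_2: "r \<ge> 2" using q_ge_2 by linarith

lemma E_nonneg: "E \<ge> 0" using q_ge_2 by (simp add: gauss_bracket_nonneg)

lemma bracket_D: "gauss_bracket q D = 1 + r * E"
  using gauss_bracket_Suc[of q "D - 1"] D_ge_2 by simp

lemma c_pos: "0 < i \<Longrightarrow> i \<le> D \<Longrightarrow> c i > 0"
proof -
  assume i: "0 < i" "i \<le> D"
  have "gauss_bracket q i = 1 + r * gauss_bracket q (i - 1)"
    using gauss_bracket_Suc[of q "i - 1"] i by simp
  then show "c i > 0"
    using i gauss_bracket_nonneg[of q "i - 1"] q_ge_2 alpha_nonneg
    by (simp add: c_eq add_pos_nonneg)
qed

lemma b_0: "b 0 = (1 + r * E) * \<beta>"
  by (simp add: b_eq bracket_D)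

text \<open>This is \<open>c D \<le> b 0\<close> divided by the bracket of \<open>D\<close>: at
  distance \<open>D\<close>, the neighbours counted by \<open>c D\<close> are among all
  neighbours.\<close>

lemma beta_lower: "1 + \<alpha> * E \<le> \<beta>"
proof -
  obtain x y where xy: "x \<in> V" "y \<in> V" "d x y = D" using diameter_attained by blast
  have "card {z \<in> V. adj y z \<and> Suc (d x z) = d x y} \<le> card {z \<in> V. adj y z}"
    using finite_V by (intro card_mono) auto
  then have "c D \<le> b 0" using degree[OF xy(2)] card_c[OF xy(1,2)] unfolding xy(3) by linarith
  then have "(1 + r * E) * (1 + \<alpha> * E) \<le> (1 + r * E) * \<beta>"
    by (simp add: b_0 c_eq bracket_D)
  moreover have "1 + r * E > 0" using r_ge_2 E_nonneg by (simp add: add_pos_nonneg)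
  ultimately show ?thesis by simp
qed

lemma beta_pos: "\<beta> > 0"
  using beta_lower alpha_nonneg E_nonneg mult_nonneg_nonneg[of \<alpha> E] by linarith

lemma a_1: "a 1 = \<beta> - 1 + r * \<alpha> * E"
  using D_ge_2 by (simp add: b_0 b_eq c_eq bracket_D gauss_bracket_Suc algebra_simps)

lemma c_2: "c 2 = (1 + r) * (1 + \<alpha>)"
  using D_ge_2 by (simp add: c_eq numeral_2_eq_2 gauss_bracket_Suc)

section \<open>The second largest eigenvalue and the local graphs\<close>

text \<open>Equals \<open>b 1 / r - 1\<close>, the case i = 1 of the eigenvalue formula b_i / q^i -
  [i].\<close>

definition \<theta>\<^sub>1 :: real where "\<theta>\<^sub>1 = E * (\<beta> - \<alpha>) - 1"

text \<open>A multiple of the cosine sequence, with initial values \<open>b 0\<close> and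
  \<open>\<theta>\<^sub>1\<close> both scaled by \<open>1 - 1 / r\<close>. It is affine in
  \<open>1 / r ^ i\<close>.\<close>

definition w\<^sub>1 :: "nat \<Rightarrow> real" where
  "w\<^sub>1 i = (\<theta>\<^sub>1 - b 0 / r) + (b 0 - \<theta>\<^sub>1) / r ^ i"

lemma w\<^sub>1_eigen:
  assumes "i \<le> D"
  shows "c i * w\<^sub>1 (i - 1) + a i * w\<^sub>1 i + b i * w\<^sub>1 (Suc i) = \<theta>\<^sub>1 * w\<^sub>1 i"
proof (cases i)
  case 0
  then show ?thesis
    using r_ge_2 by (simp add: c_0 w\<^sub>1_def field_simps)
next
  case (Suc j)
  define G where "G = gauss_bracket q j"
  define X where "X = r ^ j"
  have X: "X = 1 + (r - 1) * G" unfolding X_def G_def by (rule power_eq_gauss_bracket)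
  have nz: "X > 0" "r > 0" using r_ge_2 by (auto simp: X_def)
  have ci: "c i = (1 + r * G) * (1 + \<alpha> * G)"
    using assms Suc by (simp add: c_eq gauss_bracket_Suc G_def)
  have bi: "b i = r * (E - G) * (\<beta> - \<alpha> * (1 + r * G))"
    using assms Suc by (simp add: b_eq bracket_D gauss_bracket_Suc G_def algebra_simps)
  \<comment> \<open>What remains of the recurrence once the factor \<open>s / (r * X)\<close> is
    taken out; with \<open>X\<close> replaced by \<open>1 + (r - 1) * G\<close> it is a polynomial
    identity.\<close>
  have "(r * \<theta>\<^sub>1 - b 0) * X
      = \<theta>\<^sub>1 - b 0 - c i * (r - 1) + (E - G) * (r - 1) * (\<beta> - \<alpha> * (1 + r * G))"
    unfolding X ci \<theta>\<^sub>1_def b_0 by algebra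
  moreover have "r * (\<theta>\<^sub>1 - b 0 / r) = r * \<theta>\<^sub>1 - b 0"
    using nz by (simp add: right_diff_distrib)
  moreover have "b i * (r - 1) / r = (E - G) * (r - 1) * (\<beta> - \<alpha> * (1 + r * G))"
    using nz unfolding bi by simp
  ultimately have key: "r * (\<theta>\<^sub>1 - b 0 / r) * X = \<theta>\<^sub>1 - b 0 - c i * (r - 1) + b i * (r - 1) / r"
    by simp
  define s where "s = b 0 - \<theta>\<^sub>1"
  define p where "p = \<theta>\<^sub>1 - b 0 / r"
  have w: "w\<^sub>1 (i - 1) = p + s / X" "w\<^sub>1 i = p + s / (r * X)" "w\<^sub>1 (Suc i) = p + s / (r * r * X)"
    using Suc by (simp_all add: w\<^sub>1_def p_def s_def X_def)
  have "c i * w\<^sub>1 (i - 1) + a i * w\<^sub>1 i + b i * w\<^sub>1 (Suc i) - \<theta>\<^sub>1 * w\<^sub>1 i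
      = s / (r * X) * (r * p * X - (\<theta>\<^sub>1 - b 0 - c i * (r - 1) + b i * (r - 1) / r))"
    unfolding w using nz by (simp add: s_def field_simps)
  also have "\<dots> = 0" using key unfolding p_def by simp
  finally show ?thesis by simp
qed

text \<open>The third fact is the source of \<open>r + 1\<close> in the local eigenvalue bound. The
  last one gives the sign of the term left over when the central vertex is eliminated.\<close>

lemma w\<^sub>1_shape:
  defines "s \<equiv> b 0 - \<theta>\<^sub>1"
  shows "s > 0" "w\<^sub>1 0 > 0" "w\<^sub>1 0 - w\<^sub>1 2 = (r + 1) * (w\<^sub>1 1 - w\<^sub>1 2)" "w\<^sub>1 1 - w\<^sub>1 2 > 0"
    "w\<^sub>1 0 * w\<^sub>1 2 \<le> w\<^sub>1 1 * w\<^sub>1 1"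
proof -
  have r: "r > 1" using r_ge_2 by simp
  have "s = (r - 1) * (E * \<beta>) + \<beta> + E * \<alpha> + 1"
    unfolding s_def \<theta>\<^sub>1_def b_0 by algebra
  moreover have "(r - 1) * (E * \<beta>) \<ge> 0" "E * \<alpha> \<ge> 0"
    using r E_nonneg beta_pos alpha_nonneg by auto
  ultimately show s: "s > 0" using beta_pos by linarith
  have b0: "b 0 > 0"
    using r E_nonneg beta_pos unfolding b_0 by (intro mult_pos_pos add_pos_nonneg) auto
  have w0: "w\<^sub>1 0 = b 0 * (r - 1) / r" using r by (simp add: w\<^sub>1_def field_simps)
  then show "w\<^sub>1 0 > 0" using b0 r by simp
  have d12: "w\<^sub>1 1 - w\<^sub>1 2 = s * (r - 1) / (r * r)"
    using r by (simp add: w\<^sub>1_def s_def field_simps power2_eq_square)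
  then show "w\<^sub>1 1 - w\<^sub>1 2 > 0" using s r by simp
  show "w\<^sub>1 0 - w\<^sub>1 2 = (r + 1) * (w\<^sub>1 1 - w\<^sub>1 2)"
    unfolding d12 using r by (simp add: w\<^sub>1_def s_def field_simps power2_eq_square)
  define p where "p = \<theta>\<^sub>1 - b 0 / r"
  have "p = - E * \<alpha> - 1 - \<beta> / r"
    using r unfolding p_def \<theta>\<^sub>1_def b_0 by (simp add: field_simps)
  moreover have "E * \<alpha> \<ge> 0" "\<beta> / r \<ge> 0"
    using E_nonneg alpha_nonneg beta_pos r by auto
  ultimately have p: "p \<le> 0" by linarith
  have "w\<^sub>1 1 * w\<^sub>1 1 - w\<^sub>1 0 * w\<^sub>1 2 = - p * s * (1 - 1 / r) * (1 - 1 / r)"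
    using r unfolding w\<^sub>1_def p_def[symmetric] s_def[symmetric]
    by (simp add: field_simps power2_eq_square)
  also have "\<dots> \<ge> 0" using p s by (simp add: mult.assoc mult_nonpos_nonneg)
  finally show "w\<^sub>1 0 * w\<^sub>1 2 \<le> w\<^sub>1 1 * w\<^sub>1 1" by simp
qed

text \<open>This is Terwilliger's bound \<open>-1 - b\<^sub>1 / (\<theta>\<^sub>1 + 1) = -(q + 1)\<close> for local graphs: restrict the
  kernel of \<open>\<theta>\<^sub>1\<close> to a vertex and its neighbours and eliminate the vertex.\<close>

lemma local_eigenvalue_bound:
  assumes x: "x \<in> V" and W: "W = {v \<in> V. adj x v}"
  shows "0 \<le> (\<Sum>u\<in>W. \<Sum>v\<in>W. f u * f v * (of_bool (adj u v) + (r + 1) * of_bool (u = v)))"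
proof -
  define S where "S = (\<Sum>u\<in>W. f u)"
  \<comment> \<open>The value at \<open>x\<close> that minimises the form when \<open>f\<close> is
    fixed on \<open>W\<close>.\<close>
  define t where "t = - w\<^sub>1 1 * S / w\<^sub>1 0"
  define F where "F u = (if u = x then t else if u \<in> W then f u else 0)" for u
  define Q where "Q = (\<Sum>u\<in>W. \<Sum>v\<in>W. f u * f v * (of_bool (adj u v) + (r + 1) * of_bool (u = v)))"
  have WV: "W \<subseteq> V" and xW: "x \<notin> W" using W x not_adj_self by auto
  have fin: "finite W" using WV finite_V finite_subset by blast
  have F: "F x = t" "\<And>u. u \<in> W \<Longrightarrow> F u = f u" "\<And>u. u \<notin> insert x W \<Longrightarrow> F u = 0"
    using xW by (auto simp: F_def)
  have dx: "d x u = 1" "d u x = 1" if "u \<in> W" for u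
    using that W x dist_1[of x u] dist_sym[of x u] by auto
  have restrict: "(\<Sum>u\<in>V. F u * h u) = t * h x + (\<Sum>u\<in>W. f u * h u)" for h
  proof -
    have "(\<Sum>u\<in>V. F u * h u) = (\<Sum>u\<in>insert x W. F u * h u)"
      using x WV finite_V F(3) by (intro sum.mono_neutral_right) auto
    then show ?thesis using xW fin F by simp
  qed
  \<comment> \<open>Two neighbours of \<open>x\<close> are at distance at most 2, so on
    \<open>W\<close> the kernel is a combination of J and A + (r + 1) I.\<close>
  have inner: "w\<^sub>1 (d u v) = w\<^sub>1 2 + (w\<^sub>1 1 - w\<^sub>1 2) * (of_bool (adj u v) + (r + 1) * of_bool (u = v))"
    if uv: "u \<in> W" "v \<in> W" for u v
  proof -
    have "d u v \<le> Suc (d u x)"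
      using uv W x by (intro dist_step) auto
    then consider "d u v = 0" | "d u v = 1" | "d u v = 2" using dx uv by fastforce
    then show ?thesis
    proof cases
      case 1
      then have "u = v" "\<not> adj u v" using uv WV dist_0[of u v] not_adj_self[of u] by auto
      then show ?thesis using 1 w\<^sub>1_shape(3) by (simp add: mult.commute)
    next
      case 2
      then have "u \<noteq> v" "adj u v" using uv WV dist_self dist_1[of u v] by auto
      then show ?thesis using 2 by simp
    next
      case 3
      then have "u \<noteq> v" "\<not> adj u v" using uv WV dist_self dist_1[of u v] by auto
      then show ?thesis using 3 by simp
    qed
  qed
  have "0 \<le> (\<Sum>u\<in>V. \<Sum>v\<in>V. F u * F v * w\<^sub>1 (d u v))"
    by (rule eigenkernel_nonneg[OF w\<^sub>1_eigen c_pos w\<^sub>1_shape(2)])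
  also have "\<dots> = (\<Sum>u\<in>V. F u * (\<Sum>v\<in>V. F v * w\<^sub>1 (d u v)))"
    by (simp add: sum_distrib_left mult.assoc)
  also have "\<dots> = t * (t * w\<^sub>1 (d x x) + (\<Sum>v\<in>W. f v * w\<^sub>1 (d x v)))
      + (\<Sum>u\<in>W. f u * (t * w\<^sub>1 (d u x) + (\<Sum>v\<in>W. f v * w\<^sub>1 (d u v))))"
    by (simp only: restrict)
  also have "(\<Sum>v\<in>W. f v * w\<^sub>1 (d x v)) = S * w\<^sub>1 1"
    using dx unfolding S_def by (simp add: sum_distrib_right)
  also have "(\<Sum>u\<in>W. f u * (t * w\<^sub>1 (d u x) + (\<Sum>v\<in>W. f v * w\<^sub>1 (d u v))))
      = (\<Sum>u\<in>W. f u * (t * w\<^sub>1 1)) + (\<Sum>u\<in>W. \<Sum>v\<in>W. f u * f v * w\<^sub>1 (d u v))"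
    using dx by (simp add: distrib_left sum.distrib sum_distrib_left mult.assoc)
  also have "(\<Sum>u\<in>W. f u * (t * w\<^sub>1 1)) = S * (t * w\<^sub>1 1)"
    unfolding S_def by (simp only: sum_distrib_right)
  also have "(\<Sum>u\<in>W. \<Sum>v\<in>W. f u * f v * w\<^sub>1 (d u v)) =
      (\<Sum>u\<in>W. \<Sum>v\<in>W. w\<^sub>1 2 * (f u * f v)
        + (w\<^sub>1 1 - w\<^sub>1 2) * (f u * f v * (of_bool (adj u v) + (r + 1) * of_bool (u = v))))"
  proof (intro sum.cong refl)
    fix u v assume "u \<in> W" "v \<in> W"
    then show "f u * f v * w\<^sub>1 (d u v) = w\<^sub>1 2 * (f u * f v)
        + (w\<^sub>1 1 - w\<^sub>1 2) * (f u * f v * (of_bool (adj u v) + (r + 1) * of_bool (u = v)))"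
      by (simp only: inner) algebra
  qed
  also have "\<dots> = w\<^sub>1 2 * (S * S) + (w\<^sub>1 1 - w\<^sub>1 2) * Q"
    unfolding S_def Q_def sum_product by (simp only: sum.distrib sum_distrib_left)
  finally have "0 \<le> t * (t * w\<^sub>1 0 + S * w\<^sub>1 1)
      + (S * (t * w\<^sub>1 1) + (w\<^sub>1 2 * (S * S) + (w\<^sub>1 1 - w\<^sub>1 2) * Q))"
    using dist_self[OF x] by simp
  also have "\<dots> = S * S * (w\<^sub>1 0 * w\<^sub>1 2 - w\<^sub>1 1 * w\<^sub>1 1) / w\<^sub>1 0 + (w\<^sub>1 1 - w\<^sub>1 2) * Q"
    using w\<^sub>1_shape(2) unfolding t_def by (simp add: field_simps)
  also have "\<dots> \<le> (w\<^sub>1 1 - w\<^sub>1 2) * Q"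
    using w\<^sub>1_shape(2,5) by (simp add: divide_le_0_iff mult_nonneg_nonpos)
  finally show ?thesis
    using w\<^sub>1_shape(4) unfolding Q_def by (simp add: zero_le_mult_iff)
qed

section \<open>The least eigenvalue and Delsarte's clique bound\<close>

text \<open>
  The cosine sequence of the least eigenvalue \<open>- [D]\<close>. The denominator may vanish for \<open>i = D\<close>, but
  \<open>w\<^sub>D (Suc D)\<close> only occurs multiplied by \<open>b D = 0\<close>.
\<close>

primrec w\<^sub>D :: "nat \<Rightarrow> real" where
  "w\<^sub>D 0 = 1"
| "w\<^sub>D (Suc i) = - w\<^sub>D i * (1 + \<alpha> * gauss_bracket q i) / (\<beta> - \<alpha> * gauss_bracket q i)"

lemma beta_minus_pos: "i < D \<Longrightarrow> \<beta> - \<alpha> * gauss_bracket q i > 0"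
proof -
  assume "i < D"
  then have "gauss_bracket q i \<le> E" using q_ge_2 by (intro gauss_bracket_mono) auto
  then have "\<alpha> * gauss_bracket q i \<le> \<alpha> * E" using alpha_nonneg by (intro mult_left_mono)
  then show ?thesis using beta_lower by linarith
qed

text \<open>The recursion makes both outer terms multiples of \<open>w\<^sub>D i\<close>, and their
  coefficients add up with \<open>a i\<close> to minus the bracket of \<open>D\<close>.\<close>

lemma w\<^sub>D_eigen:
  assumes "i \<le> D"
  shows "c i * w\<^sub>D (i - 1) + a i * w\<^sub>D i + b i * w\<^sub>D (Suc i) = - gauss_bracket q D * w\<^sub>D i"
proof -
  have up: "b i * w\<^sub>D (Suc i)
      = - (gauss_bracket q D - gauss_bracket q i) * (1 + \<alpha> * gauss_bracket q i) * w\<^sub>D i"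
  proof (cases "i = D")
    case False
    then show ?thesis using beta_minus_pos[of i] assms by (simp add: b_eq) (simp add: algebra_simps)
  qed (simp add: b_eq)
  show ?thesis
  proof (cases i)
    case 0
    then show ?thesis using up by (simp add: c_0)
  next
    case (Suc j)
    define G where "G = gauss_bracket q j"
    have G: "gauss_bracket q i = 1 + r * G" using Suc by (simp add: gauss_bracket_Suc G_def)
    have "G \<ge> 0" using q_ge_2 by (simp add: G_def gauss_bracket_nonneg)
    then have pos: "1 + \<alpha> * G > 0" "\<beta> - \<alpha> * G > 0"
      using alpha_nonneg beta_minus_pos[of j] Suc assms by (auto simp: G_def add_pos_nonneg)
    have "c i * w\<^sub>D (i - 1) = - (1 + r * G) * (\<beta> - \<alpha> * G) * w\<^sub>D i"
      using pos Suc assms G by (simp add: c_eq G_def[symmetric] field_simps)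
    moreover have "c i = (1 + r * G) * (1 + \<alpha> * G)"
      using assms Suc G by (simp add: c_eq G_def)
    moreover have "b i = (gauss_bracket q D - (1 + r * G)) * (\<beta> - \<alpha> * (1 + r * G))"
      using assms G by (simp add: b_eq)
    moreover have "b 0 = gauss_bracket q D * \<beta>" by (simp add: b_eq)
    ultimately show ?thesis using up unfolding G by algebra
  qed
qed

text \<open>The kernel takes the values 1 and \<open>- 1 / \<beta>\<close> on a clique, so its form
  on the indicator vector is \<open>n * (1 - (n - 1) / \<beta>)\<close>.\<close>

lemma delsarte_clique_bound:
  assumes C: "C \<subseteq> V" "C \<noteq> {}" and clique: "\<And>u v. u \<in> C \<Longrightarrow> v \<in> C \<Longrightarrow> u \<noteq> v \<Longrightarrow> adj u v"
  shows "card C \<le> 1 + \<beta>"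
proof -
  define n where "n = real (card C)"
  have fin: "finite C" using C finite_V finite_subset by blast
  then have n: "n > 0" using C by (simp add: n_def card_gt_0_iff)
  have "0 \<le> (\<Sum>u\<in>V. \<Sum>v\<in>V. of_bool (u \<in> C) * of_bool (v \<in> C) * w\<^sub>D (d u v))"
    by (rule eigenkernel_nonneg[OF w\<^sub>D_eigen c_pos]) simp_all
  also have "\<dots> = (\<Sum>u\<in>V. if u \<in> C then (\<Sum>v\<in>V. if v \<in> C then w\<^sub>D (d u v) else 0) else 0)"
    by (intro sum.cong refl) (auto intro!: sum.cong)
  also have "\<dots> = (\<Sum>u\<in>C. \<Sum>v\<in>C. w\<^sub>D (d u v))"
    using C(1) finite_V by (simp add: sum.inter_restrict[symmetric] Int_absorb1)
  also have "\<dots> = (\<Sum>u\<in>C. \<Sum>v\<in>C. (if u = v then 1 + 1 / \<beta> else 0) - 1 / \<beta>)"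
  proof (intro sum.cong refl)
    fix u v assume uv: "u \<in> C" "v \<in> C"
    show "w\<^sub>D (d u v) = (if u = v then 1 + 1 / \<beta> else 0) - 1 / \<beta>"
    proof (cases "u = v")
      case True
      then show ?thesis using uv C dist_self by auto
    next
      case False
      then have "d u v = 1" using clique[of u v] dist_1[of u v] uv C by auto
      then show ?thesis using False by simp
    qed
  qed
  also have "\<dots> = n * (1 + 1 / \<beta> - n / \<beta>)"
    using fin by (simp add: sum.distrib sum_subtractf n_def algebra_simps)
  finally have "1 + 1 / \<beta> - n / \<beta> \<ge> 0"
    using n by (simp add: zero_le_mult_iff)
  then have "n / \<beta> \<le> (1 + \<beta>) / \<beta>"
    using beta_pos by (simp add: add_divide_distrib)
  then show ?thesis
    using beta_pos unfolding n_def by (simp add: divide_le_cancel)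
qed

text \<open>Nonadjacent neighbours of \<open>x\<close> are at distance 2, hence the bound
  \<open>c 2\<close>. The degree \<open>a 1\<close> is a real number that counts vertices, so
  \<open>nat\<close> and floor only change its type.\<close>

lemma local_graph:
  assumes x: "x \<in> V" and W: "W = {v \<in> V. adj x v}"
  shows "bounded_eigenvalue_graph W adj (r + 1) (c 2) (nat \<lfloor>a 1\<rfloor>)"
proof
  have WV: "W \<subseteq> V" using W by auto
  show "finite W" using WV finite_V finite_subset by blast
  show "adj u v \<longleftrightarrow> adj v u" if "u \<in> W" "v \<in> W" for u v
    using that WV adj_sym by blast
  show "\<not> adj u u" if "u \<in> W" for u using that WV not_adj_self by blast
  show "r + 1 > 1" using r_ge_2 by simp
  show "c 2 \<ge> 0" using c_pos[of 2] D_ge_2 by simp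
  show "0 \<le> (\<Sum>u\<in>W. \<Sum>v\<in>W. f u * f v * (of_bool (adj u v) + (r + 1) * of_bool (u = v)))" for f
    by (rule local_eigenvalue_bound[OF x W])
  show "card {v \<in> W. adj u v} = nat \<lfloor>a 1\<rfloor>" if u: "u \<in> W" for u
  proof -
    have xu: "u \<in> V" "d x u = 1" using u W x dist_1[of x u] by auto
    have "{v \<in> W. adj u v} = {z \<in> V. adj u z \<and> d x z = d x u}"
      unfolding xu(2) using W dist_1[OF x] by auto
    then have "real (card {v \<in> W. adj u v}) = a 1" using card_a[OF x xu(1)] xu(2) by simp
    then show ?thesis by linarith
  qed
  show "real (card {z \<in> W. adj u z \<and> adj v z}) \<le> c 2"
    if uv: "u \<in> W" "v \<in> W" "u \<noteq> v" "\<not> adj u v" for u v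
  proof -
    have V: "u \<in> V" "v \<in> V" "adj x v" "adj x u" using uv W by auto
    have "d u x = 1" using V x dist_1[of u x] adj_sym by auto
    then have "d u v \<le> 2" using dist_step[of u x v] V x by simp
    moreover have "d u v \<noteq> 0" "d u v \<noteq> 1" using uv V dist_0 dist_1[of u v] by auto
    ultimately have two: "d u v = 2" by linarith
    have "card {z \<in> W. adj u z \<and> adj v z} \<le> card {z \<in> V. adj v z \<and> Suc (d u z) = d u v}"
      using WV finite_V two V dist_1[of u] by (intro card_mono) auto
    then show ?thesis using card_c[OF V(1,2)] two by simp
  qed
qed

end

section \<open>Numerical estimates\<close>

text \<open>Here \<open>h\<close> stands for \<alpha> [D-1], so \<open>\<beta> + r * h\<close> is
  a_1 + 1. The product is concave in \<open>p\<close>, so it is bounded by its values near the ends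
  of the admissible range.\<close>

lemma quadratic_size_bound:
  fixes r h \<beta> p :: real
  assumes r: "r \<ge> 2" and h: "h > 0" "h \<le> \<beta>" and p: "p \<le> \<beta>"
    and p_lower: "2 * (\<beta> + r * h) \<le> 3 * (r + 1) * p"
  shows "4 / 3 * (\<beta> * h) \<le> p * (\<beta> + r * h - p)"
proof (cases "p \<ge> r * h")
  case True
  have "0 \<le> (\<beta> - p) * (p - r * h)" using True p by simp
  then have "\<beta> * (r * h) \<le> p * (\<beta> + r * h - p)" by (simp add: algebra_simps)
  moreover have "4 / 3 * (\<beta> * h) \<le> r * (\<beta> * h)" using r h by (intro mult_right_mono) auto
  moreover have "\<beta> * (r * h) = r * (\<beta> * h)" by simp
  ultimately show ?thesis by linarith
next
  case False
  define S where "S = \<beta> + r * h"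
  define t where "t = 2 / (3 * (r + 1))"
  have rh: "r * h \<le> r * \<beta>" using r h by (intro mult_left_mono) auto
  have t: "t * S \<le> p" using p_lower r unfolding t_def S_def by (simp add: field_simps)
  have "0 \<le> r * \<beta>" using r h by simp
  then have "2 * S \<le> 3 * (r * \<beta> + \<beta>)" using rh h unfolding S_def distrib_left by linarith
  then have "t * S \<le> \<beta>" using r unfolding t_def by (simp add: field_simps)
  \<comment> \<open>The second factor is the sum of \<open>\<beta> - t * S\<close> and
    \<open>r * h - p\<close>, both nonnegative in this case.\<close>
  then have "0 \<le> (p - t * S) * (S - t * S - p)"
    using t False unfolding S_def by (intro mult_nonneg_nonneg) auto
  then have 1: "t * (1 - t) * S\<^sup>2 \<le> p * (S - p)" by (simp add: algebra_simps power2_eq_square)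
  have "0 \<le> (\<beta> - r * h)\<^sup>2" by simp
  then have "4 * r * (\<beta> * h) \<le> S\<^sup>2" unfolding S_def by (simp add: power2_eq_square algebra_simps)
  moreover have "t * (1 - t) = 2 * (3 * r + 1) / (9 * (r + 1)\<^sup>2)"
    using r unfolding t_def by (simp add: field_simps power2_eq_square)
  ultimately have 2: "t * (1 - t) * (4 * r * (\<beta> * h)) \<le> t * (1 - t) * S\<^sup>2"
    using r by (intro mult_left_mono) auto
  have "2 * r \<le> r\<^sup>2" using r by (simp add: power2_eq_square)
  then have "12 * (r\<^sup>2 + 2 * r + 1) \<le> 24 * r\<^sup>2 + 8 * r" using r by simp
  then have "4 / 3 * (9 * (r + 1)\<^sup>2) \<le> 2 * (3 * r + 1) * (4 * r)"
    by (simp add: power2_eq_square algebra_simps)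
  then have "4 / 3 \<le> t * (1 - t) * (4 * r)"
    unfolding \<open>t * (1 - t) = _\<close> using r by (simp add: pos_le_divide_eq)
  then have "4 / 3 * (\<beta> * h) \<le> t * (1 - t) * (4 * r) * (\<beta> * h)"
    using h by (intro mult_right_mono) auto
  then show ?thesis using 1 2 unfolding S_def by (simp only: mult.assoc)
qed

text \<open>Eight terms correspond to [D-1] for D = 9. At \<open>r = 2\<close> the claim is 252
  \<le> 255, so 28 is the largest possible integer constant.\<close>

lemma geometric_sum_8_lower:
  fixes r :: real
  assumes "r \<ge> 2"
  shows "28 * (r + 1)\<^sup>2 \<le> (\<Sum>j<8. r ^ j)"
proof -
  have p: "2 ^ j * r\<^sup>2 \<le> r ^ (j + 2)" for j
    using assms power_mono[of 2 r j] by (simp add: power_add mult_right_mono power2_eq_square)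
  have "2 * r \<le> r\<^sup>2" using assms by (simp add: power2_eq_square)
  moreover have "(\<Sum>j<8. r ^ j) = 1 + r + r\<^sup>2 + r ^ 3 + r ^ 4 + r ^ 5 + r ^ 6 + r ^ 7"
    by (simp add: eval_nat_numeral)
  moreover have "(r + 1)\<^sup>2 = r\<^sup>2 + 2 * r + 1" by (simp add: power2_sum)
  moreover have "2 * r\<^sup>2 \<le> r ^ 3" using p[of 1] by (simp add: eval_nat_numeral)
  ultimately show ?thesis
    using assms p[of 2] p[of 3] p[of 4] p[of 5] by simp
qed

section \<open>Estimates under the assumption that the bound on \<alpha> fails\<close>

context
  fixes r E \<alpha> \<beta> :: real
  assumes r: "r \<ge> 2" and E: "28 * (r + 1)\<^sup>2 \<le> E" and \<alpha>: "r\<^sup>2 * (r + 1) + 1 \<le> \<alpha>"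
    and \<beta>: "1 + \<alpha> * E \<le> \<beta>"
begin

lemma alpha_ge_13: "13 \<le> \<alpha>"
proof -
  have "2\<^sup>2 * (2 + 1) \<le> r\<^sup>2 * (r + 1)" using r by (intro mult_mono power_mono) auto
  then show ?thesis using \<alpha> by simp
qed

lemma valency_lower: "28 * \<alpha> * (r + 1) ^ 3 \<le> \<beta> - 1 + r * \<alpha> * E"
proof -
  have "\<alpha> * (r + 1) * (28 * (r + 1)\<^sup>2) \<le> \<alpha> * (r + 1) * E"
    using E alpha_ge_13 r by (intro mult_left_mono) auto
  then show ?thesis using \<beta> by (simp add: algebra_simps power2_eq_square power3_eq_cube)
qed

lemma mu_upper: "(1 + r) * (1 + \<alpha>) \<le> 14 / 13 * \<alpha> * (r + 1)"
  using alpha_ge_13 r mult_right_mono[of "1 + \<alpha>" "14 / 13 * \<alpha>" "r + 1"]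
  by (simp add: algebra_simps)

text \<open>The first two bounds feed the clique construction and yield a clique of size at least
  2/3 of (k + 1) / m; the third makes \<open>\<mu>\<close> at most 1/8 of that size.\<close>

lemma large_valency:
  defines "m \<equiv> r + 1" and "\<mu> \<equiv> (1 + r) * (1 + \<alpha>)" and "k \<equiv> \<beta> - 1 + r * \<alpha> * E"
  shows "m + (4 * m + 1) * \<mu> \<le> k / (2 * m)"
    and "2 * (k + 1) / (3 * m) \<le> k / m - m - 4 * m * \<mu>"
    and "8 * \<mu> \<le> 2 * (k + 1) / (3 * m)"
proof -
  have m: "m \<ge> 3" using r by (simp add: m_def)
  have k: "28 * \<alpha> * m ^ 3 \<le> k" using valency_lower by (simp add: k_def m_def)
  have \<mu>: "\<mu> \<le> 14 / 13 * (\<alpha> * m)" using mu_upper by (simp add: \<mu>_def m_def mult_ac)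
  \<comment> \<open>Common scale: \<open>k / m\<close> is at least 28 \<open>T\<close>, while
    \<open>m * \<mu>\<close>, \<open>\<mu>\<close> and \<open>m\<close> are at most 14/13, 14/39 and
    1/39 of \<open>T\<close>.\<close>
  define T where "T = \<alpha> * m * m"
  have T: "3 * (\<alpha> * m) \<le> T" "39 * m \<le> T"
  proof -
    show "3 * (\<alpha> * m) \<le> T" unfolding T_def using m alpha_ge_13
      mult_left_mono[of 3 m "\<alpha> * m"] by (simp add: mult_ac)
    moreover have "13 * m \<le> \<alpha> * m" using m alpha_ge_13 by (intro mult_right_mono) auto
    ultimately show "39 * m \<le> T" by linarith
  qed
  have km: "28 * T \<le> k / m"
    using k m unfolding T_def by (simp add: field_simps power3_eq_cube)
  have mm: "m * \<mu> \<le> 14 / 13 * T"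
    using \<mu> m mult_left_mono[of \<mu> "14 / 13 * (\<alpha> * m)" m] unfolding T_def by (simp add: mult_ac)
  have "(4 * m + 1) * \<mu> = 4 * (m * \<mu>) + \<mu>" by (simp add: algebra_simps)
  moreover have "k / (2 * m) = (k / m) / 2" by simp
  ultimately show "m + (4 * m + 1) * \<mu> \<le> k / (2 * m)"
    using km mm T \<mu> m by linarith
  have e: "2 * (k + 1) / (3 * m) = 2 / 3 * (k / m) + 2 / 3 * (1 / m)"
    using m by (simp add: field_simps)
  have "1 / m \<le> 1" "0 < 1 / m" using m by auto
  then show "2 * (k + 1) / (3 * m) \<le> k / m - m - 4 * m * \<mu>"
    "8 * \<mu> \<le> 2 * (k + 1) / (3 * m)"
    using e km mm T \<mu> m by linarith+
qed

text \<open>Reverses the edge count for maximal cliques. The correction by \<open>\<mu>\<close>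
  costs a factor 7/8, and 7/8 times the 4/3 of \<open>quadratic_size_bound\<close> is 7/6, still
  above the 101/100 on the other side.\<close>

lemma no_clique_size:
  defines "m \<equiv> r + 1" and "\<mu> \<equiv> (1 + r) * (1 + \<alpha>)" and "k \<equiv> \<beta> - 1 + r * \<alpha> * E"
  assumes p: "2 * (k + 1) / (3 * m) \<le> p" "p \<le> \<beta>"
  shows "((1 + r * E) * \<beta> - p) * (m * (m - 1) * (p + m - 1))
    < p * (k + 1 - p) * (p + m - 1 - \<mu>)"
proof -
  define h where "h = \<alpha> * E"
  have E0: "252 \<le> E"
  proof -
    have "28 * 3\<^sup>2 \<le> 28 * (r + 1)\<^sup>2" using r by (intro mult_left_mono power_mono) auto
    then show ?thesis using E by simp
  qed
  have h: "h > 0" "h \<le> \<beta>" using E0 alpha_ge_13 \<beta> by (auto simp: h_def)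
  have m: "m \<ge> 3" using r by (simp add: m_def)
  have k1: "k + 1 = \<beta> + r * h" by (simp add: k_def h_def)
  have quad: "4 / 3 * (\<beta> * h) \<le> p * (k + 1 - p)"
    unfolding k1
  proof (rule quadratic_size_bound[OF r h p(2)])
    show "2 * (\<beta> + r * h) \<le> 3 * (r + 1) * p"
      using p(1) m unfolding k1[symmetric] m_def[symmetric] by (simp add: field_simps)
  qed
  have \<mu>0: "\<mu> > 0" using r alpha_ge_13 by (simp add: \<mu>_def)
  have "8 * \<mu> \<le> p" using large_valency(3) p(1) unfolding m_def \<mu>_def k_def by linarith
  then have p_pos: "p > 0" and p\<mu>: "7 / 8 * (p + m - 1) \<le> p + m - 1 - \<mu>"
    using \<mu>0 m by (auto simp: field_simps)
  have bh: "\<beta> * h > 0" using h by simp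
  \<comment> \<open>The origin of the cubic bound: the leading term is
    \<open>r\<^sup>2 * m * E\<close>, at most \<open>\<alpha> * E\<close>. The remainder
    \<open>m * r\<close> is at most \<alpha>, hence below one percent of \<open>h\<close>.\<close>
  have "(1 + r * E) * (m * (m - 1)) \<le> 101 / 100 * h"
  proof -
    have rm: "r\<^sup>2 * m \<le> \<alpha>" using \<alpha> by (simp add: m_def)
    have "(1 + r * E) * (m * (m - 1)) = m * r + r\<^sup>2 * m * E"
      by (simp add: m_def algebra_simps power2_eq_square)
    moreover have "m * r \<le> r\<^sup>2 * m"
      using m r by (simp add: power2_eq_square)
    moreover have "r\<^sup>2 * m * E \<le> \<alpha> * E" using rm E0 by (intro mult_right_mono) auto
    moreover have "\<alpha> * 100 \<le> \<alpha> * E" using E0 alpha_ge_13 by (intro mult_left_mono) auto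
    ultimately show ?thesis using rm unfolding h_def by linarith
  qed
  then have "\<beta> * ((1 + r * E) * (m * (m - 1))) \<le> \<beta> * (101 / 100 * h)"
    using h by (intro mult_left_mono) auto
  moreover have "0 \<le> p * (m * (m - 1))" using p_pos m by simp
  ultimately have "((1 + r * E) * \<beta> - p) * (m * (m - 1)) \<le> 101 / 100 * (\<beta> * h)"
    by (simp add: algebra_simps)
  also have "\<dots> < 7 / 6 * (\<beta> * h)" using bh by simp
  also have "\<dots> \<le> 7 / 8 * (p * (k + 1 - p))" using quad by simp
  finally have "((1 + r * E) * \<beta> - p) * (m * (m - 1)) * (p + m - 1)
      < 7 / 8 * (p * (k + 1 - p)) * (p + m - 1)"
    using p_pos m by (intro mult_strict_right_mono) auto
  also have "\<dots> = p * (k + 1 - p) * (7 / 8 * (p + m - 1))" by simp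
  also have "\<dots> \<le> p * (k + 1 - p) * (p + m - 1 - \<mu>)"
    using p\<mu> quad bh by (intro mult_left_mono) auto
  finally show ?thesis by (simp add: mult.assoc)
qed

end

section \<open>The bound on \<alpha>\<close>

context classical_scheme
begin

lemma alpha_less:
  assumes "D \<ge> 9"
  shows "\<alpha> < r\<^sup>2 * (r + 1) + 1"
proof (rule ccontr)
  assume "\<not> ?thesis"
  then have \<alpha>: "r\<^sup>2 * (r + 1) + 1 \<le> \<alpha>" by simp
  define m where "m = r + 1"
  define \<mu> where "\<mu> = (1 + r) * (1 + \<alpha>)"
  define k where "k = \<beta> - 1 + r * \<alpha> * E"
  \<comment> \<open>The hypothesis \<open>D \<ge> 9\<close> enters through [D-1] \<ge> [8].\<close>
  have "28 * (r + 1)\<^sup>2 \<le> gauss_bracket q 8"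
    unfolding gauss_bracket_def by (rule geometric_sum_8_lower[OF r_ge_2])
  also have "\<dots> \<le> E" using assms q_ge_2 by (intro gauss_bracket_mono) auto
  finally have E: "28 * (r + 1)\<^sup>2 \<le> E" .
  note params = r_ge_2 E \<alpha> beta_lower
  note valency = large_valency[OF params, folded m_def \<mu>_def k_def]
  have \<mu>: "c 2 = \<mu>" by (simp add: c_2 \<mu>_def)
  have \<mu>_pos: "\<mu> > 0" using r_ge_2 alpha_nonneg by (simp add: \<mu>_def)
  have m: "m > 0" using r_ge_2 by (simp add: m_def)
  have "0 < k / (2 * m)" using valency(1) \<mu>_pos m by (smt (verit) mult_pos_pos)
  then have k_pos: "k > 0" using m by (simp add: zero_less_divide_iff)
  obtain x where x: "x \<in> V" using diameter_attained by blast
  define W where "W = {v \<in> V. adj x v}"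
  have WV: "W \<subseteq> V" by (auto simp: W_def)
  have card_W: "real (card W) = (1 + r * E) * \<beta>"
    using degree[OF x] b_0 unfolding W_def by simp
  define n where "n = nat \<lfloor>a 1\<rfloor>"
  interpret bounded_eigenvalue_graph W adj m "c 2" n
    unfolding m_def n_def by (rule local_graph[OF x W_def])
  have "1 + r * E > 0" using r_ge_2 E_nonneg by (simp add: add_pos_nonneg)
  then have "real (card W) > 0" using card_W beta_pos by simp
  then obtain y where y: "y \<in> W" by fastforce
  have n: "real n = k"
  proof -
    have yV: "y \<in> V" "d x y = 1" using y x dist_1[of x y] by (auto simp: W_def)
    have "a 1 = real (card {z \<in> V. adj y z \<and> d x z = d x y})"
      using card_a[OF x yV(1)] yV(2) by simp
    then have "real n = a 1" unfolding n_def by simp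
    then show ?thesis using a_1 unfolding k_def by simp
  qed
  have "W \<noteq> {}" using y by auto
  moreover have "n > 0" using n k_pos by simp
  moreover have "n / (2 * m) \<ge> m + (4 * m + 1) * c 2" using valency(1) unfolding n \<mu> .
  moreover have "n / m - m - 4 * m * c 2 > c 2"
    using valency(2,3) \<mu>_pos unfolding n \<mu> by linarith
  ultimately obtain F where F: "clique F" "card F \<ge> n / m - m - 4 * m * c 2"
    and count: "card F * (n + 1 - real (card F)) * (card F + m - 1 - c 2)
      \<le> (card W - real (card F)) * (m * (m - 1) * (card F + m - 1))"
    by (rule clique_size_inequality)
  have FW: "F \<subseteq> W" using F(1) by (simp add: clique_def)
  then have fin: "finite F" using finite_W finite_subset by blast
  have xF: "x \<notin> F" using FW not_adj_self[OF x] by (auto simp: W_def)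
  \<comment> \<open>Adding the central vertex keeps a clique, which sharpens the bound for
    \<open>F\<close> to \<open>\<beta>\<close>.\<close>
  have "real (card (insert x F)) \<le> 1 + \<beta>"
  proof (rule delsarte_clique_bound)
    show "insert x F \<subseteq> V" "insert x F \<noteq> {}" using FW WV x by auto
    have xadj: "adj x u" "adj u x" if "u \<in> F" for u
      using that FW adj_sym[OF x, of u] by (auto simp: W_def)
    show "adj u v" if "u \<in> insert x F" "v \<in> insert x F" "u \<noteq> v" for u v
      using that F(1) xadj unfolding clique_def by auto
  qed
  then have upper: "real (card F) \<le> \<beta>" using fin xF by simp
  have lower: "2 * (k + 1) / (3 * m) \<le> real (card F)"
    using F(2) valency(2) unfolding n \<mu> by linarith
  have "((1 + r * E) * \<beta> - real (card F)) * (m * (m - 1) * (real (card F) + m - 1))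
      < real (card F) * (k + 1 - real (card F)) * (real (card F) + m - 1 - \<mu>)"
    using no_clique_size[OF params, folded m_def \<mu>_def k_def, OF lower upper] .
  then show False using count[unfolded of_nat_add of_nat_1 n \<mu> card_W] by (meson leD)
qed

end

section \<open>Graph distance as a metric scheme\<close>

context graph
begin

lemma graph_dist_walk:
  assumes "u \<rightarrow>\<^sup>* v"
  obtains p where "awalk u p v" "length p = graph_dist G u v"
proof -
  have "\<exists>n p. awalk u p v \<and> length p = n"
    using assms by (simp add: reachable_awalk)
  then have "\<exists>p. awalk u p v \<and> length p = graph_dist G u v"
    unfolding graph_dist_def by (rule LeastI_ex)
  then show thesis using that by blast
qed

lemma graph_dist_le: "awalk u p v \<Longrightarrow> graph_dist G u v \<le> length p"
  unfolding graph_dist_def by (intro Least_le) auto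

text \<open>A walk is a list of arcs, so reversing it means replacing each arc by its opposite,
  which symmetry provides.\<close>

lemma awalk_rev_exists: "awalk u p v \<Longrightarrow> \<exists>p'. awalk v p' u \<and> length p' = length p"
proof (induction p arbitrary: u)
  case Nil
  then show ?case by (auto simp: awalk_Nil_iff)
next
  case (Cons e p)
  then have e: "e \<in> arcs G" "u = tail G e" "awalk (head G e) p v"
    by (auto simp: awalk_Cons_iff)
  then obtain p' where p': "awalk v p' (head G e)" "length p' = length p"
    using Cons.IH by blast
  obtain e' where e': "e' \<in> arcs G" "tail G e' = head G e" "head G e' = tail G e"
    using sym_arcs e(1) unfolding symmetric_conv by metis
  have "awalk (head G e) [e'] u"
    using arc_implies_awalk[OF e'(1)] e' e(2) by simp
  then have "awalk v (p' @ [e']) u" using p'(1) by (rule awalk_appendI[rotated])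
  then show ?case using p'(2) by (intro exI[of _ "p' @ [e']"]) simp
qed

lemma graph_dist_sym:
  assumes "u \<rightarrow>\<^sup>* v"
  shows "graph_dist G u v = graph_dist G v u"
proof -
  have "graph_dist G v u \<le> graph_dist G u v" if uv: "u \<rightarrow>\<^sup>* v" for u v
  proof -
    obtain p where p: "awalk u p v" "length p = graph_dist G u v" using graph_dist_walk[OF uv] .
    then obtain p' where "awalk v p' u" "length p' = length p" using awalk_rev_exists by blast
    then show ?thesis using graph_dist_le p by metis
  qed
  moreover have "v \<rightarrow>\<^sup>* u" using sym_arcs assms by (rule symmetric_reachable)
  ultimately show ?thesis using assms by (simp add: antisym)
qed

lemma graph_dist_0_iff:
  assumes "u \<rightarrow>\<^sup>* v"
  shows "graph_dist G u v = 0 \<longleftrightarrow> u = v"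
proof
  assume "graph_dist G u v = 0"
  then show "u = v" using graph_dist_walk[OF assms] by (metis awalk_Nil_iff length_0_conv)
next
  assume "u = v"
  moreover have "u \<in> verts G" using assms by (rule reachable_in_vertsE)
  ultimately show "graph_dist G u v = 0"
    using graph_dist_le[of u "[]" v] by (simp add: awalk_Nil_iff)
qed

lemma graph_dist_1_iff:
  assumes "u \<rightarrow>\<^sup>* v"
  shows "graph_dist G u v = 1 \<longleftrightarrow> u \<rightarrow> v"
proof
  assume "graph_dist G u v = 1"
  then obtain p where p: "awalk u p v" "length p = 1" using graph_dist_walk[OF assms] by metis
  then obtain e where "p = [e]" by (cases p) auto
  then have "e \<in> arcs G" "arc_to_ends G e = (u, v)"
    using p(1) by (simp_all add: awalk_simps arc_to_ends_def)
  then show "u \<rightarrow> v" by (rule dominatesI[rotated])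
next
  assume uv: "u \<rightarrow> v"
  then obtain e where "e \<in> arcs G" "tail G e = u" "head G e = v" by (rule reachableE)
  then have "graph_dist G u v \<le> 1"
    using arc_implies_awalk[of e] graph_dist_le[of u "[e]" v] by simp
  moreover have "u \<noteq> v" using uv adj_not_same by auto
  ultimately show "graph_dist G u v = 1" using graph_dist_0_iff[OF assms] by linarith
qed

lemma graph_dist_step:
  assumes "u \<rightarrow>\<^sup>* v" "v \<rightarrow> z"
  shows "graph_dist G u z \<le> Suc (graph_dist G u v)"
proof -
  obtain p where p: "awalk u p v" "length p = graph_dist G u v" using graph_dist_walk[OF assms(1)] .
  obtain e where "e \<in> arcs G" "tail G e = v" "head G e = z" using assms(2) by (rule reachableE)
  then have "awalk v [e] z" using arc_implies_awalk[of e] by simp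
  then have "awalk u (p @ [e]) z" using p(1) by (rule awalk_appendI[rotated])
  then show ?thesis using graph_dist_le[of u "p @ [e]" z] p(2) by simp
qed

lemma metric_scheme_graph:
  assumes conn: "Digraph_Component.connected G" and inter: "intersection_numbers G bs cs"
  shows "metric_scheme (verts G) (\<lambda>u v. u \<rightarrow> v) (graph_dist G) (diameter G)
    (\<lambda>i. real_of_int (bs i)) (\<lambda>i. real_of_int (cs i))"
proof
  \<comment> \<open>Connectedness refers to the symmetric closure; for symmetric arcs reachability
    there agrees with reachability in \<open>G\<close>.\<close>
  have reach: "u \<rightarrow>\<^sup>* v" if "u \<in> verts G" "v \<in> verts G" for u v
    using conn that reachable_mk_symmetric_eq[OF sym_arcs]
    unfolding Digraph_Component.connected_def strongly_connected_def by simp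
  have ne: "verts G \<noteq> {}"
    using conn unfolding Digraph_Component.connected_def strongly_connected_def by simp
  let ?S = "{graph_dist G u v | u v. u \<in> verts G \<and> v \<in> verts G}"
  have "?S = (\<lambda>(u, v). graph_dist G u v) ` (verts G \<times> verts G)" by auto
  then have S: "finite ?S" "?S \<noteq> {}" using ne by auto
  show "finite (verts G)" by simp
  show "\<exists>x\<in>verts G. \<exists>y\<in>verts G. graph_dist G x y = diameter G"
    using Max_in[OF S] unfolding diameter_def[symmetric] by force
  fix x y assume xy: "x \<in> verts G" "y \<in> verts G"
  show "graph_dist G x y = 0 \<longleftrightarrow> x = y" using reach[OF xy] by (rule graph_dist_0_iff)
  show "graph_dist G x y = 1 \<longleftrightarrow> x \<rightarrow> y" using reach[OF xy] by (rule graph_dist_1_iff)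
  show "graph_dist G x y = graph_dist G y x" using reach[OF xy] by (rule graph_dist_sym)
  show le: "graph_dist G x y \<le> diameter G"
    using Max_ge[OF S(1)] xy unfolding diameter_def by blast
  show "graph_dist G x z \<le> Suc (graph_dist G x y)" if "z \<in> verts G" "y \<rightarrow> z" for z
    using reach[OF xy] that(2) by (rule graph_dist_step)
  have cards: "int (card {z \<in> verts G. y \<rightarrow> z \<and> graph_dist G x z + 1 = graph_dist G x y})
      = cs (graph_dist G x y)"
    "int (card {z \<in> verts G. y \<rightarrow> z \<and> graph_dist G x z = graph_dist G x y + 1})
      = bs (graph_dist G x y)"
    using inter xy le unfolding intersection_numbers_def by blast+
  show "real (card {z \<in> verts G. y \<rightarrow> z \<and> Suc (graph_dist G x z) = graph_dist G x y})
      = real_of_int (cs (graph_dist G x y))"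
    using arg_cong[OF cards(1), of real_of_int] by simp
  show "real (card {z \<in> verts G. y \<rightarrow> z \<and> graph_dist G x z = Suc (graph_dist G x y)})
      = real_of_int (bs (graph_dist G x y))"
    using arg_cong[OF cards(2), of real_of_int] by simp
qed

end

theorem theorem1p1:
  fixes G :: "('a, 'b) pre_digraph"
    and D :: nat and b :: int and \<alpha> \<beta> :: real
  assumes "D > 0" and "b > 0"
    and "distance_regular G"
    and "classical_parameters G D b \<alpha> \<beta>"
    and "D \<ge> 9" and "b \<ge> 2"
  shows "\<alpha> < real_of_int (b\<^sup>2 * (b + 1) + 1)"
proof (cases "\<alpha> \<ge> 0")
  \<comment> \<open>The kernel arguments need \<alpha> \<ge> 0; a negative \<alpha> lies below the
    positive right-hand side.\<close>
  case False
  moreover have "b\<^sup>2 * (b + 1) \<ge> 0" using assms(2) by simp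
  then have "real_of_int (b\<^sup>2 * (b + 1) + 1) > 0" by (simp only: of_int_0_less_iff)
  ultimately show ?thesis by linarith
next
  case True
  obtain bs cs where inter: "intersection_numbers G bs cs" and D: "diameter G = D"
    and eqs: "\<And>i. i \<le> D \<Longrightarrow>
      real_of_int (cs i) = gauss_bracket b i * (1 + \<alpha> * gauss_bracket b (i - 1)) \<and>
      real_of_int (bs i) = (gauss_bracket b D - gauss_bracket b i) * (\<beta> - \<alpha> * gauss_bracket b i)"
    using assms(4) unfolding classical_parameters_def by blast
  interpret graph G using assms(3) unfolding distance_regular_def by simp
  interpret metric_scheme "verts G" "\<lambda>u v. u \<rightarrow>\<^bsub>G\<^esub> v" "graph_dist G" D
    "\<lambda>i. real_of_int (bs i)" "\<lambda>i. real_of_int (cs i)"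
    using metric_scheme_graph[OF _ inter] assms(3) D unfolding distance_regular_def by simp
  interpret classical_scheme "verts G" "\<lambda>u v. u \<rightarrow>\<^bsub>G\<^esub> v" "graph_dist G" D
    "\<lambda>i. real_of_int (bs i)" "\<lambda>i. real_of_int (cs i)" b \<alpha> \<beta>
    by unfold_locales (use assms True eqs in auto)
  show ?thesis using alpha_less assms(5) by simp
qed

end
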